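(* Let $\psi:\Sigma^2\to\mathcal H^3$ be a complete spacelike vertical graph in the $3$-dimensional Steady State space $\mathcal H^3=-\mathbb R\times_{e^t}\mathbb R^2$, with constant mean curvature $H\ge1$. Let $h$ be its height function and $\theta$ its hyperbolic angle. If $$h\le-\log(\cosh\theta-1)$$ on $\Sigma$, where the right-hand side is interpreted as $+\infty$ at points where $\cosh\theta=1$, then $\psi(\Sigma)$ is a slice of $\mathcal H^3$, i.e. $\psi(\Sigma)=\{t_0\}\times\mathbb R^2$ for some $t_0\in\mathbb R$.
   Context: The Steady State space $\mathcal H^{3}=-\mathbb R\times_{e^t}\mathbb R^2$ is the manifold $\mathbb R\times\mathbb R^2$ with the Lorentzian metric $\langle\,,\rangle=-dt^2+e^{2t}\langle\,,\rangle_{\mathbb R^2}$, where $\langle\,,\rangle_{\mathbb R^2}$ is the Euclidean metric; $\partial_t$ is the coordinate vector field of the first factor, and the slices are the sets $\{t_0\}\times\mathbb R^2$. A (spacelike) vertical graph is an immersion $\psi$ with Riemannian induced metric of the form $\psi(x)=(u(x),x)$ for a smooth function $u:\mathbb R^2\to[0,+\infty)$, so that $\Sigma$ is identified with $\mathbb R^2$ (the slice $\{0\}\times\mathbb R^2$) endowed with the metric induced by $\psi$. Complete means that this induced metric is complete. The height function $h:\Sigma\to\mathbb R$ is the restriction to $\Sigma$ of the projection onto the first factor; thus $h=u\ge0$. $\Sigma$ is oriented by the timelike unit normal field $N$ with $\langle N,\partial_t\rangle<0$; the hyperbolic angle is the function $\theta\ge 0$ with $\cosh\theta=-\langle N,\partial_t\rangle\ge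 1$. With $\overline\nabla$ the Levi-Civita connection of $\mathcal H^{3}$, the shape operator is $AX=-\overline\nabla_XN$ and the mean curvature is $H=-\mathrm{tr}(A)/2$ (with this convention the slices, oriented by $N=\partial_t$, have $H=1$). *)

theory Defs
  imports "HOL-Analysis.Analysis"
begin

section \<open>Smooth maps\<close>

primrec C_k :: "nat \<Rightarrow> ('a::euclidean_space \<Rightarrow> 'b::real_normed_vector) \<Rightarrow> bool" where
  "C_k 0 f \<longleftrightarrow> continuous_on UNIV f"
| "C_k (Suc k) f \<longleftrightarrow> (\<forall>x. f differentiable (at x)) \<and>
     (\<forall>v. C_k k (\<lambda>x. frechet_derivative f (at x) v))"

definition smooth :: "('a::euclidean_space \<Rightarrow> 'b::real_normed_vector) \<Rightarrow> bool" where
  "smooth f \<longleftrightarrow> (\<forall>k. C_k k f)"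

section \<open>The Steady State space\<close>

text \<open>The manifold is covered by one global chart, so every tangent space is identified with
  the model space itself. The first component is the time coordinate.\<close>

type_synonym steady_state = "real \<times> (real^2)"

definition ss_metric :: "steady_state \<Rightarrow> steady_state \<Rightarrow> steady_state \<Rightarrow> real" where
  "ss_metric p v w = - (fst v * fst w) + exp (2 * fst p) * (snd v \<bullet> snd w)"

definition d_t :: steady_state where
  "d_t = (1, 0)"

definition slice :: "real \<Rightarrow> steady_state set" where
  "slice t = {t} \<times> UNIV"

text \<open>In the global chart a connection is \<open>D\<^sub>X Y = dY(X) + \<Gamma>(X, Y)\<close> with \<open>\<Gamma>\<close> bilinear at each
  point. It is torsion free iff \<open>\<Gamma>\<close> is symmetric, and compatible with the metric iff the last
  clause below holds (the product rule for constant-coefficient fields \<open>v\<close>, \<open>w\<close>). Existence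
  and uniqueness are part of \<open>ss_christoffel_eq\<close>.\<close>

definition is_levi_civita_at ::
    "steady_state \<Rightarrow> (steady_state \<Rightarrow> steady_state \<Rightarrow> steady_state) \<Rightarrow> bool" where
  "is_levi_civita_at p G \<longleftrightarrow> bilinear G \<and> (\<forall>v w. G v w = G w v) \<and>
     (\<forall>z v w. frechet_derivative (\<lambda>q. ss_metric q v w) (at p) z =
        ss_metric p (G z v) w + ss_metric p v (G z w))"

definition ss_christoffel :: "steady_state \<Rightarrow> steady_state \<Rightarrow> steady_state \<Rightarrow> steady_state" where
  "ss_christoffel p = (THE G. is_levi_civita_at p G)"

section \<open>Spacelike surfaces\<close>

type_synonym surface = "real^2 \<Rightarrow> steady_state"

definition tangent_map :: "surface \<Rightarrow> real^2 \<Rightarrow> real^2 \<Rightarrow> steady_state" where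
  "tangent_map \<psi> x X = frechet_derivative \<psi> (at x) X"

definition induced_metric :: "surface \<Rightarrow> real^2 \<Rightarrow> real^2 \<Rightarrow> real^2 \<Rightarrow> real" where
  "induced_metric \<psi> x X Y = ss_metric (\<psi> x) (tangent_map \<psi> x X) (tangent_map \<psi> x Y)"

definition spacelike_immersion :: "surface \<Rightarrow> bool" where
  "spacelike_immersion \<psi> \<longleftrightarrow> smooth \<psi> \<and> (\<forall>x. inj (tangent_map \<psi> x)) \<and>
     (\<forall>x X. X \<noteq> 0 \<longrightarrow> induced_metric \<psi> x X X > 0)"

definition spacelike_vertical_graph :: "surface \<Rightarrow> bool" where
  "spacelike_vertical_graph \<psi> \<longleftrightarrow> spacelike_immersion \<psi> \<and>
     (\<exists>u :: real^2 \<Rightarrow> real. smooth u \<and> (\<forall>x. u x \<ge> 0) \<and> (\<forall>x. \<psi> x = (u x, x)))"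

definition height :: "surface \<Rightarrow> real^2 \<Rightarrow> real" where
  "height \<psi> x = fst (\<psi> x)"

subsection \<open>Completeness of the induced metric\<close>

definition speed :: "surface \<Rightarrow> (real \<Rightarrow> real^2) \<Rightarrow> real \<Rightarrow> real" where
  "speed \<psi> \<gamma> s = sqrt (induced_metric \<psi> (\<gamma> s)
     (vector_derivative \<gamma> (at s)) (vector_derivative \<gamma> (at s)))"

text \<open>A \<^const>\<open>valid_path\<close> may have unbounded derivative near its exceptional points, hence
  infinite length. Such paths have no integral of the speed and do not contribute.\<close>

definition induced_dist :: "surface \<Rightarrow> real^2 \<Rightarrow> real^2 \<Rightarrow> real" where
  "induced_dist \<psi> x y = Inf {l. \<exists>\<gamma>. valid_path \<gamma> \<and> pathstart \<gamma> = x \<and> pathfinish \<gamma> = y \<and>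
     (speed \<psi> \<gamma> has_integral l) {0..1}}"

definition complete_surface :: "surface \<Rightarrow> bool" where
  "complete_surface \<psi> \<longleftrightarrow> Metric_space.mcomplete (UNIV :: (real^2) set) (induced_dist \<psi>)"

subsection \<open>Unit normal, hyperbolic angle and mean curvature\<close>

definition unit_normal :: "surface \<Rightarrow> real^2 \<Rightarrow> steady_state" where
  "unit_normal \<psi> x = (THE n. (\<forall>X. ss_metric (\<psi> x) n (tangent_map \<psi> x X) = 0) \<and>
     ss_metric (\<psi> x) n n = -1 \<and> ss_metric (\<psi> x) n d_t < 0)"

definition hyperbolic_angle :: "surface \<Rightarrow> real^2 \<Rightarrow> real" where
  "hyperbolic_angle \<psi> x =
     (THE \<theta>. \<theta> \<ge> 0 \<and> cosh \<theta> = - ss_metric (\<psi> x) (unit_normal \<psi> x) d_t)"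

definition cov_deriv_along :: "surface \<Rightarrow> surface \<Rightarrow> real^2 \<Rightarrow> real^2 \<Rightarrow> steady_state" where
  "cov_deriv_along \<psi> V x X =
     frechet_derivative V (at x) X + ss_christoffel (\<psi> x) (tangent_map \<psi> x X) (V x)"

text \<open>Tangent vectors of the surface are identified with vectors of the plane via the tangent
  map, so the shape operator is an endomorphism of the plane.\<close>

definition shape_operator :: "surface \<Rightarrow> real^2 \<Rightarrow> real^2 \<Rightarrow> real^2" where
  "shape_operator \<psi> x X =
     (THE Y. tangent_map \<psi> x Y = - cov_deriv_along \<psi> (unit_normal \<psi>) x X)"

definition mean_curvature :: "surface \<Rightarrow> real^2 \<Rightarrow> real" where
  "mean_curvature \<psi> x = - trace (matrix (shape_operator \<psi> x)) / 2"

section \<open>Well-definedness of the connection, and the slices\<close>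

lemma ss_metric_has_derivative:
  "((\<lambda>q. ss_metric q v w) has_derivative
     (\<lambda>z. 2 * fst z * exp (2 * fst p) * (snd v \<bullet> snd w))) (at p)"
  unfolding ss_metric_def by (auto intro!: derivative_eq_intros simp: algebra_simps)

lemma ss_metric_sym: "ss_metric p v w = ss_metric p w v"
  by (simp add: ss_metric_def inner_commute)

lemma ss_metric_nondegenerate:
  assumes "\<And>w. ss_metric p v w = ss_metric p v' w"
  shows "v = v'"
proof -
  have "fst v = fst v'" using assms[of "(1, 0)"] by (simp add: ss_metric_def)
  moreover have "snd v \<bullet> y = snd v' \<bullet> y" for y
    using assms[of "(0, y)"] by (simp add: ss_metric_def)
  hence "snd v = snd v'" using vector_eq_rdot by blast
  ultimately show ?thesis by (simp add: prod_eq_iff)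
qed

lemma is_levi_civita_at_unique:
  assumes G: "is_levi_civita_at p G" and G': "is_levi_civita_at p G'"
  shows "G = G'"
proof (intro ext)
  fix v w
  have koszul: "2 * ss_metric p (F v w) z =
      frechet_derivative (\<lambda>q. ss_metric q w z) (at p) v
    + frechet_derivative (\<lambda>q. ss_metric q v z) (at p) w
    - frechet_derivative (\<lambda>q. ss_metric q v w) (at p) z"
    if "is_levi_civita_at p F" for F z
  proof -
    from that have s: "\<And>v w. F v w = F w v"
      and m: "\<And>z v w. frechet_derivative (\<lambda>q. ss_metric q v w) (at p) z =
        ss_metric p (F z v) w + ss_metric p v (F z w)"
      unfolding is_levi_civita_at_def by blast+
    show ?thesis
      using s[of w v] s[of z v] s[of z w] ss_metric_sym[of p "F v z" w]
      unfolding m by (simp add: ss_metric_sym)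
  qed
  show "G v w = G' v w"
  proof (rule ss_metric_nondegenerate)
    show "ss_metric p (G v w) z = ss_metric p (G' v w) z" for z
      using koszul[OF G, of z] koszul[OF G', of z] by linarith
  qed
qed

lemma ss_christoffel_eq:
  "ss_christoffel p v w =
     (exp (2 * fst p) * (snd v \<bullet> snd w), fst v *\<^sub>R snd w + fst w *\<^sub>R snd v)"
proof -
  let ?G = "\<lambda>v w :: steady_state.
     (exp (2 * fst p) * (snd v \<bullet> snd w), fst v *\<^sub>R snd w + fst w *\<^sub>R snd v)"
  have lc: "is_levi_civita_at p ?G"
    unfolding is_levi_civita_at_def
  proof (intro conjI allI)
    show "bilinear ?G"
      unfolding bilinear_def
      by (intro conjI allI linearI)
         (auto simp: algebra_simps inner_add_left inner_add_right)
    show "?G v w = ?G w v" for v w by (simp add: inner_commute add.commute)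
    show "frechet_derivative (\<lambda>q. ss_metric q v w) (at p) z =
        ss_metric p (?G z v) w + ss_metric p v (?G z w)" for z v w
      using frechet_derivative_at[OF ss_metric_has_derivative[of v w p], symmetric]
      by (simp add: ss_metric_def algebra_simps inner_add_left inner_add_right inner_commute)
  qed
  hence "ss_christoffel p = ?G"
    unfolding ss_christoffel_def
    using is_levi_civita_at_unique[OF _ lc] by (intro the_equality lc)
  thus ?thesis by simp
qed

lemma mean_curvature_slice: "mean_curvature (\<lambda>x. (t, x)) x = 1"
proof -
  let ?\<psi> = "\<lambda>x :: real^2. (t, x)"
  have "(?\<psi> has_derivative (\<lambda>X. (0, X))) (at y)" for y
    by (auto intro!: derivative_eq_intros)
  from frechet_derivative_at[OF this, symmetric]
  have T: "tangent_map ?\<psi> y X = (0, X)" for y X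
    by (simp add: tangent_map_def)
  have "unit_normal ?\<psi> y = d_t" for y
    unfolding unit_normal_def
  proof (rule the_equality)
    fix n
    assume n: "(\<forall>X. ss_metric (?\<psi> y) n (tangent_map ?\<psi> y X) = 0) \<and>
      ss_metric (?\<psi> y) n n = -1 \<and> ss_metric (?\<psi> y) n d_t < 0"
    hence "snd n \<bullet> snd n = 0" by (auto simp: ss_metric_def T)
    hence s: "snd n = 0" by simp
    with n have "fst n * fst n = 1" "fst n > 0" by (auto simp: ss_metric_def d_t_def)
    hence "fst n = 1" using square_eq_1_iff by fastforce
    with s show "n = d_t" by (simp add: d_t_def prod_eq_iff)
  qed (auto simp: ss_metric_def d_t_def T)
  hence N: "unit_normal ?\<psi> = (\<lambda>y. d_t)" by blast
  have "cov_deriv_along ?\<psi> (unit_normal ?\<psi>) x X = (0, X)" for X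
    by (simp add: cov_deriv_along_def N T ss_christoffel_eq d_t_def)
  hence "shape_operator ?\<psi> x X = - X" for X
    by (simp add: shape_operator_def T)
  hence "shape_operator ?\<psi> x = (\<lambda>X. - X)" by blast
  thus ?thesis
    by (simp add: mean_curvature_def trace_def matrix_def axis_def sum_2)
qed

end

theory Submission
  imports Defs
begin

text \<open>Put \<open>w = e\<^sup>-\<^sup>u\<close> and \<open>V = cosh \<theta> = (1 - |Dw|\<^sup>2)\<^sup>-\<^sup>1\<^sup>/\<^sup>2\<close>. The steady state space is conformal to
  Minkowski space, and constant mean curvature becomes \<open>div (V Dw) = 2 F\<close> with \<open>F = (V - H) / w\<close>.
  The hypothesis reads \<open>V \<le> 1 + w\<close>; it gives \<open>F \<le> 1\<close> and \<open>V \<le> 2\<close>, so the Laplacian of the graph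
  is a uniformly elliptic divergence form operator on the plane and a logarithmic cutoff shows
  that its subharmonic functions bounded above are constant. Now \<open>F\<close> is subharmonic, by the
  Codazzi equation and \<open>2 |A|\<^sup>2 \<ge> (tr A)\<^sup>2\<close>, hence constant; then the bounded function \<open>w\<close> is sub- or
  superharmonic according to the sign of \<open>F\<close>, hence constant.\<close>

section \<open>Calculus of smooth functions on the plane\<close>

text \<open>The height has no upper bound, so \<open>w\<close> may come arbitrarily close to 0, and
  a quotient by \<open>w\<close> such as \<open>F\<close> has no evident upper bound. The hypothesis
  is exactly what repairs this: it bounds \<open>V - 1\<close>, and hence \<open>V - H\<close>, by
  \<open>w\<close> itself. Passing to the Minkowski picture is harmless because in dimension two a
  conformal change of metric only rescales the Laplacian by a positive factor. Once \<open>V\<close>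
  is at most 2, the Laplacian is comparable with the Euclidean one, so cutoffs depending on the
  Euclidean radius suffice and no intrinsic distance or curvature estimate enters. The Liouville
  theorem is stated for a pair of a field \<open>Y\<close> and a function \<open>F\<close> coupled
  by \<open>|Y|^2 / 2 <= Y . DF\<close>, with no metric or operator named. In this form it applies
  to the flux of \<open>F\<close> and also to the normal field \<open>X\<close> paired with
  \<open>w\<close>, or \<open>- X\<close> with \<open>- w\<close>.\<close>

lemma C_k_Suc_imp: "C_k (Suc k) f \<Longrightarrow> C_k k f"
proof (induction k arbitrary: f)
  case 0
  then show ?case
    by (auto intro!: differentiable_imp_continuous_on simp: differentiable_on_def
        intro: differentiable_at_withinI)
next
  case (Suc k)
  then show ?case by (metis C_k.simps(2))
qed

lemma C_k_const: "C_k k (\<lambda>x. c)"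
  by (induction k arbitrary: c) auto

lemma frechet_derivative_eqI:
  "(f has_derivative f') (at x) \<Longrightarrow> frechet_derivative f (at x) = f'"
  by (metis frechet_derivative_at)

lemma C_k_add:
  assumes "C_k k f" "C_k k g"
  shows "C_k k (\<lambda>x. f x + g x)"
  using assms
proof (induction k arbitrary: f g)
  case 0
  then show ?case by (auto intro: continuous_on_add)
next
  case (Suc k)
  have "frechet_derivative (\<lambda>x. f x + g x) (at x) =
      (\<lambda>v. frechet_derivative f (at x) v + frechet_derivative g (at x) v)" for x
    using Suc.prems
    by (intro frechet_derivative_eqI has_derivative_add) (auto simp: frechet_derivative_works)
  then show ?case using Suc by auto
qed

lemma C_k_mult:
  fixes f g :: "'a::euclidean_space \<Rightarrow> real"
  assumes "C_k k f" "C_k k g"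
  shows "C_k k (\<lambda>x. f x * g x)"
  using assms
proof (induction k arbitrary: f g)
  case 0
  then show ?case by (auto intro: continuous_on_mult)
next
  case (Suc k)
  have "frechet_derivative (\<lambda>x. f x * g x) (at x) =
      (\<lambda>v. f x * frechet_derivative g (at x) v + frechet_derivative f (at x) v * g x)" for x
    using Suc.prems
    by (intro frechet_derivative_eqI has_derivative_mult) (auto simp: frechet_derivative_works)
  moreover have "C_k k f" "C_k k g" using Suc.prems C_k_Suc_imp by blast+
  ultimately show ?case using Suc.prems
    by (auto intro!: C_k_add Suc.IH differentiable_mult)
qed

text \<open>Regularity of the composed derivative is a hypothesis, so that a family closed under
  differentiation, such as powers or \<open>exp\<close>, can supply it from its own induction
  hypothesis.\<close>

lemma C_k_chain:
  fixes f :: "'a::euclidean_space \<Rightarrow> real"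
  assumes "C_k (Suc k) f" "\<And>x. (\<phi> has_real_derivative \<phi>' (f x)) (at (f x))"
    "C_k k (\<lambda>x. \<phi>' (f x))"
  shows "C_k (Suc k) (\<lambda>x. \<phi> (f x))"
proof -
  have f: "(f has_derivative frechet_derivative f (at x)) (at x)" for x
    using assms(1) by (auto simp: frechet_derivative_works)
  have d: "((\<lambda>x. \<phi> (f x)) has_derivative (\<lambda>v. \<phi>' (f x) * frechet_derivative f (at x) v)) (at x)" for x
    using has_derivative_compose[OF f assms(2)[THEN has_field_derivative_imp_has_derivative]]
    by simp
  have "frechet_derivative (\<lambda>x. \<phi> (f x)) (at x) =
      (\<lambda>v. \<phi>' (f x) * frechet_derivative f (at x) v)" for x
    using d by (rule frechet_derivative_eqI)
  moreover have "C_k k (\<lambda>x. frechet_derivative f (at x) v)" for v using assms(1) by auto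
  ultimately show ?thesis using assms(3) d
    by (auto simp: differentiable_def intro!: C_k_mult)
qed

text \<open>Differentiation lowers the exponent, so the induction runs over all \<open>r\<close> at
  once. Exponent -1 gives quotients, exponent -1/2 the function \<open>V\<close>.\<close>

lemma C_k_powr:
  fixes f :: "'a::euclidean_space \<Rightarrow> real"
  assumes "C_k k f" "\<And>x. f x > 0"
  shows "C_k k (\<lambda>x. f x powr r)"
  using assms
proof (induction k arbitrary: r)
  case 0
  then show ?case
    using continuous_on_powr[of UNIV f "\<lambda>_. r"] by (simp add: less_imp_neq[symmetric])
next
  case (Suc k)
  have "C_k k (\<lambda>x. r * f x powr (r - 1))"
    using Suc C_k_Suc_imp by (intro C_k_mult C_k_const Suc.IH) auto
  then show ?case
    using Suc.prems
    by (intro C_k_chain[where f = f and \<phi> = "\<lambda>y. y powr r" and \<phi>' = "\<lambda>y. r * y powr (r - 1)"]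
        has_real_derivative_powr)
qed

lemma C_k_exp:
  fixes f :: "'a::euclidean_space \<Rightarrow> real"
  assumes "C_k k f"
  shows "C_k k (\<lambda>x. exp (f x))"
  using assms
proof (induction k)
  case 0
  then show ?case by (simp add: continuous_on_exp)
next
  case (Suc k)
  then show ?case
    by (intro C_k_chain[where f = f and \<phi> = exp and \<phi>' = exp] DERIV_exp Suc.IH Suc.prems
        C_k_Suc_imp[OF Suc.prems])
qed

lemma smooth_const: "smooth (\<lambda>x. c)"
  by (simp add: smooth_def C_k_const)

lemma smooth_add: "smooth f \<Longrightarrow> smooth g \<Longrightarrow> smooth (\<lambda>x. f x + g x)"
  by (simp add: smooth_def C_k_add)

lemma smooth_mult:
  fixes f g :: "'a::euclidean_space \<Rightarrow> real"
  shows "smooth f \<Longrightarrow> smooth g \<Longrightarrow> smooth (\<lambda>x. f x * g x)"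
  by (simp add: smooth_def C_k_mult)

lemma smooth_powr:
  fixes f :: "'a::euclidean_space \<Rightarrow> real"
  shows "smooth f \<Longrightarrow> (\<And>x. f x > 0) \<Longrightarrow> smooth (\<lambda>x. f x powr r)"
  by (simp add: smooth_def C_k_powr)

lemma smooth_exp:
  fixes f :: "'a::euclidean_space \<Rightarrow> real"
  shows "smooth f \<Longrightarrow> smooth (\<lambda>x. exp (f x))"
  by (simp add: smooth_def C_k_exp)

lemma smooth_minus:
  fixes f :: "'a::euclidean_space \<Rightarrow> real"
  shows "smooth f \<Longrightarrow> smooth (\<lambda>x. - f x)"
  using smooth_mult[OF smooth_const[of "-1"], of f] by simp

lemma smooth_diff:
  fixes f g :: "'a::euclidean_space \<Rightarrow> real"
  shows "smooth f \<Longrightarrow> smooth g \<Longrightarrow> smooth (\<lambda>x. f x - g x)"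
  using smooth_add[OF _ smooth_minus, of f g] by simp

lemma smooth_divide:
  fixes f g :: "'a::euclidean_space \<Rightarrow> real"
  assumes "smooth f" "smooth g" "\<And>x. g x > 0"
  shows "smooth (\<lambda>x. f x / g x)"
proof -
  have "(\<lambda>x. f x / g x) = (\<lambda>x. f x * g x powr (-1))"
    by (simp add: powr_neg_one assms(3) abs_of_pos del: powr_minus)
  then show ?thesis using assms by (simp only: smooth_mult smooth_powr)
qed

lemma smooth_frechet_derivative: "smooth f \<Longrightarrow> smooth (\<lambda>x. frechet_derivative f (at x) v)"
  unfolding smooth_def by (metis C_k.simps(2))

lemma smooth_differentiable: "smooth f \<Longrightarrow> f differentiable (at x)"
  unfolding smooth_def by (metis C_k.simps(2))

lemma smooth_continuous_on: "smooth f \<Longrightarrow> continuous_on S f"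
  unfolding smooth_def by (metis C_k.simps(1) continuous_on_subset subset_UNIV)

section \<open>Partial derivatives on the plane\<close>

definition pd :: "2 \<Rightarrow> (real^2 \<Rightarrow> real) \<Rightarrow> real^2 \<Rightarrow> real" where
  "pd i f x = frechet_derivative f (at x) (axis i 1)"

lemma smooth_pd: "smooth f \<Longrightarrow> smooth (pd i f)"
  using smooth_frechet_derivative[of f "axis i 1"] by (simp add: pd_def[abs_def])

lemmas smooth_intros =
  smooth_const smooth_add smooth_mult smooth_minus smooth_diff smooth_divide smooth_exp smooth_pd

lemma pd_eqI: "(f has_derivative f') (at x) \<Longrightarrow> pd i f x = f' (axis i 1)"
  by (simp add: pd_def frechet_derivative_eqI)

lemma vec2_eq: "(v :: real^2) = v$1 *\<^sub>R axis 1 1 + v$2 *\<^sub>R axis 2 1"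
  by (simp add: vec_eq_iff forall_2 axis_def)

lemma has_derivative_pd:
  fixes f :: "real^2 \<Rightarrow> real"
  assumes "f differentiable (at x)"
  shows "(f has_derivative (\<lambda>v. v$1 * pd 1 f x + v$2 * pd 2 f x)) (at x)"
proof -
  have d: "(f has_derivative frechet_derivative f (at x)) (at x)"
    using assms by (simp add: frechet_derivative_works)
  then interpret linear "frechet_derivative f (at x)"
    using assms linear_frechet_derivative by blast
  have eq: "frechet_derivative f (at x) = (\<lambda>v. v$1 * pd 1 f x + v$2 * pd 2 f x)"
    by (rule ext, subst vec2_eq) (simp add: add scaleR pd_def)
  show ?thesis using d by (simp only: eq)
qed

lemma pd_add:
  "f differentiable (at x) \<Longrightarrow> g differentiable (at x) \<Longrightarrow>
    pd i (\<lambda>y. f y + g y) x = pd i f x + pd i g x"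
  unfolding pd_def frechet_derivative_works
  by (subst frechet_derivative_eqI[OF has_derivative_add]) auto

lemma pd_minus: "f differentiable (at x) \<Longrightarrow> pd i (\<lambda>y. - f y) x = - pd i f x"
  unfolding pd_def frechet_derivative_works
  by (subst frechet_derivative_eqI[OF has_derivative_minus]) auto

lemma pd_diff:
  "f differentiable (at x) \<Longrightarrow> g differentiable (at x) \<Longrightarrow>
    pd i (\<lambda>y. f y - g y) x = pd i f x - pd i g x"
  unfolding pd_def frechet_derivative_works
  by (subst frechet_derivative_eqI[OF has_derivative_diff]) auto

lemma pd_const: "pd i (\<lambda>y. c) x = 0"
  by (simp add: pd_def)

lemma pd_mult:
  "f differentiable (at x) \<Longrightarrow> g differentiable (at x) \<Longrightarrow>
    pd i (\<lambda>y. f y * g y) x = f x * pd i g x + pd i f x * g x"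
  unfolding pd_def frechet_derivative_works
  by (subst frechet_derivative_eqI[OF has_derivative_mult]) auto

lemma pd_chain:
  assumes "f differentiable (at x)" "(\<phi> has_real_derivative d) (at (f x))"
  shows "pd i (\<lambda>y. \<phi> (f y)) x = d * pd i f x"
  using has_derivative_compose[OF assms(1)[unfolded frechet_derivative_works]
      assms(2)[THEN has_field_derivative_imp_has_derivative]]
  by (simp add: pd_def frechet_derivative_eqI)

text \<open>Integration takes place over rectangles of pairs, where iterated integrals apply;
  \<open>pt\<close> carries pairs to points of the plane.\<close>

definition pt :: "real \<times> real \<Rightarrow> real^2" where
  "pt p = vector [fst p, snd p]"

lemma pt_nth [simp]: "pt p $ 1 = fst p" "pt p $ 2 = snd p"
  by (simp_all add: pt_def)

lemma pt_surj: "x = pt (x$1, x$2)"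
  by (simp add: vec_eq_iff forall_2)

lemma pt_eq: "pt p = fst p *\<^sub>R axis 1 1 + snd p *\<^sub>R axis 2 1"
  by (subst vec2_eq) simp

lemma continuous_on_pt [continuous_intros]:
  "continuous_on S a \<Longrightarrow> continuous_on S b \<Longrightarrow> continuous_on S (\<lambda>x. pt (a x, b x))"
  unfolding pt_eq by (simp add: continuous_on_add continuous_on_scaleR continuous_on_const)

lemma continuous_on_comp_pt:
  "continuous_on UNIV f \<Longrightarrow> continuous_on S (\<lambda>p. f (pt p))"
  using continuous_on_compose2[of UNIV f S pt]
    continuous_on_pt[OF continuous_on_fst[OF continuous_on_id] continuous_on_snd[OF continuous_on_id]]
  by simp

lemma pd_along_1:
  assumes "f differentiable (at (pt (a, b)))"
  shows "((\<lambda>a. f (pt (a, b))) has_real_derivative pd 1 f (pt (a, b))) (at a within S)"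
proof -
  have "((\<lambda>a. pt (a, b)) has_derivative (\<lambda>h. h *\<^sub>R axis 1 1)) (at a within S)"
    unfolding pt_eq by (auto intro!: derivative_eq_intros)
  from has_derivative_compose[OF this has_derivative_pd[OF assms]]
  show ?thesis
    by (simp add: has_field_derivative_def axis_def mult_commute_abs)
qed

lemma pd_along_2:
  assumes "f differentiable (at (pt (a, b)))"
  shows "((\<lambda>b. f (pt (a, b))) has_real_derivative pd 2 f (pt (a, b))) (at b within S)"
proof -
  have "((\<lambda>b. pt (a, b)) has_derivative (\<lambda>h. h *\<^sub>R axis 2 1)) (at b within S)"
    unfolding pt_eq by (auto intro!: derivative_eq_intros)
  from has_derivative_compose[OF this has_derivative_pd[OF assms]]
  show ?thesis
    by (simp add: has_field_derivative_def axis_def mult_commute_abs)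
qed

lemma integral_pd_1:
  assumes "\<And>x. f differentiable (at x)" "a \<le> b"
  shows "((\<lambda>s. pd 1 f (pt (s, t))) has_integral f (pt (b, t)) - f (pt (a, t))) (cbox a b)"
  using assms
  by (auto intro!: fundamental_theorem_of_calculus
      simp: has_real_derivative_iff_has_vector_derivative[symmetric] pd_along_1)

lemma integral_pd_2:
  assumes "\<And>x. f differentiable (at x)" "a \<le> b"
  shows "((\<lambda>s. pd 2 f (pt (t, s))) has_integral f (pt (t, b)) - f (pt (t, a))) (cbox a b)"
  using assms
  by (auto intro!: fundamental_theorem_of_calculus
      simp: has_real_derivative_iff_has_vector_derivative[symmetric] pd_along_2)

lemma integral_pt_iterated:
  fixes f :: "real^2 \<Rightarrow> real"
  assumes "continuous_on UNIV f"
  shows "integral (cbox (a, c) (b, d)) (\<lambda>p. f (pt p)) =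
      integral (cbox a b) (\<lambda>s. integral (cbox c d) (\<lambda>t. f (pt (s, t))))"
    and "integral (cbox (a, c) (b, d)) (\<lambda>p. f (pt p)) =
      integral (cbox c d) (\<lambda>t. integral (cbox a b) (\<lambda>s. f (pt (s, t))))"
proof -
  show *: "integral (cbox (a, c) (b, d)) (\<lambda>p. f (pt p)) =
      integral (cbox a b) (\<lambda>s. integral (cbox c d) (\<lambda>t. f (pt (s, t))))"
    by (rule integral_prod_continuous continuous_on_comp_pt assms)+
  show "integral (cbox (a, c) (b, d)) (\<lambda>p. f (pt p)) =
      integral (cbox c d) (\<lambda>t. integral (cbox a b) (\<lambda>s. f (pt (s, t))))"
    unfolding *
    by (rule integral_swap_continuous)
       (use continuous_on_comp_pt[OF assms] in \<open>simp add: case_prod_unfold\<close>)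
qed

text \<open>Both mixed derivatives integrate to the same combination of corner values over every
  rectangle.\<close>

lemma pd_commute:
  assumes "smooth f"
  shows "pd 1 (pd 2 f) x = pd 2 (pd 1 f) x"
proof -
  define g where "g = (\<lambda>x. pd 1 (pd 2 f) x - pd 2 (pd 1 f) x)"
  have sm: "smooth (pd 1 (pd 2 f))" "smooth (pd 2 (pd 1 f))" by (intro smooth_pd assms)+
  have g: "continuous_on UNIV g" unfolding g_def by (intro smooth_continuous_on smooth_diff sm)
  have int: "integral (cbox (a, c) (b, d)) (\<lambda>p. g (pt p)) = 0" if "a \<le> b" "c \<le> d" for a b c d
  proof -
    have d: "pd i f differentiable (at x)" "f differentiable (at x)" for i x
      by (intro smooth_differentiable smooth_pd assms)+
    have 1: "integral (cbox (a, c) (b, d)) (\<lambda>p. pd 1 (pd 2 f) (pt p)) =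
        f (pt (b, d)) - f (pt (b, c)) - (f (pt (a, d)) - f (pt (a, c)))"
    proof -
      have "integral (cbox a b) (\<lambda>s. pd 1 (pd 2 f) (pt (s, t))) =
          pd 2 f (pt (b, t)) - pd 2 f (pt (a, t))" for t
        using integral_pd_1[OF d(1)] that by blast
      moreover have "((\<lambda>t. pd 2 f (pt (b, t)) - pd 2 f (pt (a, t))) has_integral
        f (pt (b, d)) - f (pt (b, c)) - (f (pt (a, d)) - f (pt (a, c)))) (cbox c d)"
        by (intro has_integral_diff integral_pd_2 d that)
      ultimately show ?thesis
        using smooth_continuous_on[OF sm(1)] by (simp add: integral_pt_iterated(2) integral_unique)
    qed
    have 2: "integral (cbox (a, c) (b, d)) (\<lambda>p. pd 2 (pd 1 f) (pt p)) =
        f (pt (b, d)) - f (pt (a, d)) - (f (pt (b, c)) - f (pt (a, c)))"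
    proof -
      have "integral (cbox c d) (\<lambda>t. pd 2 (pd 1 f) (pt (s, t))) =
          pd 1 f (pt (s, d)) - pd 1 f (pt (s, c))" for s
        using integral_pd_2[OF d(1)] that by blast
      moreover have "((\<lambda>s. pd 1 f (pt (s, d)) - pd 1 f (pt (s, c))) has_integral
        f (pt (b, d)) - f (pt (a, d)) - (f (pt (b, c)) - f (pt (a, c)))) (cbox a b)"
        by (intro has_integral_diff integral_pd_1 d that)
      ultimately show ?thesis
        using smooth_continuous_on[OF sm(2)] by (simp add: integral_pt_iterated(1) integral_unique)
    qed
    have "integral (cbox (a, c) (b, d)) (\<lambda>p. g (pt p)) =
       integral (cbox (a, c) (b, d)) (\<lambda>p. pd 1 (pd 2 f) (pt p)) -
       integral (cbox (a, c) (b, d)) (\<lambda>p. pd 2 (pd 1 f) (pt p))"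
      unfolding g_def
      by (intro integral_diff integrable_continuous continuous_on_comp_pt smooth_continuous_on sm)
    then show ?thesis using 1 2 by simp
  qed
  \<comment> \<open>The factor \<open>sgn c\<close> treats both signs together: a continuous
    function that is positive on a whole square cannot have integral 0 there.\<close>
  have "\<exists>q \<in> cbox (s, t) (s + e, t + e). g (pt q) * sgn c \<le> 0" if "e > 0" for s t e c
  proof (rule ccontr)
    assume "\<not> ?thesis"
    then have pos: "g (pt q) * sgn c > 0" if "q \<in> cbox (s, t) (s + e, t + e)" for q
      using that by force
    have c: "continuous_on (cbox (s, t) (s + e, t + e)) (\<lambda>q. g (pt q) * sgn c)"
      by (intro continuous_intros continuous_on_comp_pt g)
    have "integral (cbox (s, t) (s + e, t + e)) (\<lambda>q. g (pt q) * sgn c) = 0"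
      using int[of s "s + e" t "t + e"] that by simp
    then have "((\<lambda>q. g (pt q) * sgn c) has_integral 0) (cbox (s, t) (s + e, t + e))"
      using integrable_integral[OF integrable_continuous[OF c]] by metis
    moreover have "box (s, t) (s + e, t + e) \<noteq> {}"
      using that by (auto simp: box_ne_empty Basis_prod_def)
    moreover have "(s, t) \<in> cbox (s, t) (s + e, t + e)"
      using that by (auto simp: cbox_Pair_eq)
    moreover have "0 \<le> g (pt q) * sgn c" if "q \<in> box (s, t) (s + e, t + e)" for q
      using pos[of q] that box_subset_cbox less_imp_le by blast
    ultimately have "g (pt (s, t)) * sgn c = 0"
      by (intro has_integral_0_cbox_imp_0[OF c])
    with pos[of "(s, t)"] that show False by (auto simp: cbox_Pair_eq)
  qed note * = this
  have "g (pt (s, t)) = 0" for s t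
  proof (rule ccontr)
    assume ne: "g (pt (s, t)) \<noteq> 0"
    define G where "G = (\<lambda>q. g (pt q) * sgn (g (pt (s, t))))"
    have "continuous_on UNIV G" unfolding G_def
      by (intro continuous_intros continuous_on_comp_pt g)
    moreover have "G (s, t) > 0" using ne by (auto simp: G_def sgn_if)
    ultimately obtain d where d: "d > 0" "\<And>q. dist q (s, t) < d \<Longrightarrow> G q > 0"
      by (metis (no_types, lifting) UNIV_I continuous_on_iff dist_real_def abs_diff_less_iff diff_self)
    \<comment> \<open>With side \<open>d/3\<close> the two coordinate differences add up to at most
      \<open>2 * d / 3\<close>, so the square lies inside the ball of radius
      \<open>d\<close>.\<close>
    obtain q where q: "q \<in> cbox (s, t) (s + d/3, t + d/3)" "G q \<le> 0"
      using *[of "d/3" s t "g (pt (s, t))"] d by (auto simp: G_def)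
    have "dist q (s, t) \<le> \<bar>fst q - s\<bar> + \<bar>snd q - t\<bar>"
      using sqrt_sum_squares_le_sum_abs[of "fst q - s" "snd q - t"]
      by (cases q) (simp add: dist_Pair_Pair dist_real_def)
    also have "\<dots> < d" using q d by (cases q) (auto simp: cbox_Pair_eq)
    finally have "dist q (s, t) < d" .
    with d(2)[of q] q(2) show False by linarith
  qed
  then show ?thesis using pt_surj[of x] by (metis g_def right_minus_eq)
qed

section \<open>A Liouville theorem for fluxes on the plane\<close>

text \<open>Squaring removes the kink at 0. This is why only the square of the cutoff is ever
  differentiated.\<close>

lemma pos_part_square_has_derivative:
  "((\<lambda>s. (max 0 s)\<^sup>2) has_real_derivative 2 * max 0 s) (at s)"
proof -
  consider "s > 0" | "s < 0" | "s = 0" by linarith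
  then show ?thesis
  proof cases
    case 1
    have "((\<lambda>s. s\<^sup>2) has_real_derivative 2 * max 0 s) (at s)"
      using 1 by (auto intro!: derivative_eq_intros)
    then show ?thesis
      by (rule has_field_derivative_transform_within_open[where S = "{0<..}"]) (use 1 in auto)
  next
    case 2
    have "((\<lambda>s. 0) has_real_derivative 2 * max 0 s) (at s)"
      using 2 by (auto intro!: derivative_eq_intros)
    then show ?thesis
      by (rule has_field_derivative_transform_within_open[where S = "{..<0}"]) (use 2 in auto)
  next
    case 3
    have "((\<lambda>h. ((max 0 h)\<^sup>2) / h) \<longlongrightarrow> 0) (at (0::real))"
    proof (rule Lim_null_comparison)
      show "\<forall>\<^sub>F h in at (0::real). norm ((max 0 h)\<^sup>2 / h) \<le> \<bar>h\<bar>"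
        by (rule always_eventually) (auto simp: max_def power2_eq_square)
      show "((\<lambda>h::real. \<bar>h\<bar>) \<longlongrightarrow> 0) (at 0)"
        using tendsto_rabs[OF tendsto_ident_at[of "0::real"]] by simp
    qed
    then show ?thesis using 3 by (simp add: DERIV_def)
  qed
qed

section \<open>The logarithmic cutoff and its energy\<close>

definition rad :: "real^2 \<Rightarrow> real" where
  "rad x = 1 + (x$1)\<^sup>2 + (x$2)\<^sup>2"

lemma rad_pos: "rad x > 0"
  unfolding rad_def by (smt (verit) zero_le_power2)

lemma rad_nonzero: "rad x \<noteq> 0"
  using rad_pos[of x] by simp

definition cutoff :: "real \<Rightarrow> real^2 \<Rightarrow> real" where
  "cutoff k x = max 0 (1 - ln (rad x) / k)"

text \<open>Gradient of the unclipped function \<open>1 - ln (rad x) / k\<close>. Where the clipping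
  is active this is not the gradient of \<open>cutoff\<close>, but there it only occurs multiplied
  by \<open>cutoff k x = 0\<close>.\<close>

definition cutoff_grad :: "real \<Rightarrow> 2 \<Rightarrow> real^2 \<Rightarrow> real" where
  "cutoff_grad k i x = - (2 * x$i / rad x / k)"

lemma cutoff_square_has_derivative:
  assumes "k > 0"
  shows "((\<lambda>x. (cutoff k x)\<^sup>2) has_derivative
    (\<lambda>v. 2 * cutoff k x * (cutoff_grad k 1 x * v$1 + cutoff_grad k 2 x * v$2))) (at x)"
proof -
  note d = bounded_linear_imp_has_derivative[OF bounded_linear_vec_nth]
  have "((\<lambda>x. 1 + x$1 * x$1 + x$2 * x$2) has_derivative
      (\<lambda>v. 0 + (x$1 * v$1 + v$1 * x$1) + (x$2 * v$2 + v$2 * x$2))) (at x)"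
    by (intro has_derivative_add has_derivative_mult has_derivative_const d)
  then have "(rad has_derivative (\<lambda>v. 2 * x$1 * v$1 + 2 * x$2 * v$2)) (at x)"
    by (simp add: rad_def[abs_def] power2_eq_square algebra_simps)
  note ln = has_derivative_ln[OF rad_pos this]
  have "((\<lambda>x. 1 - ln (rad x) * (1 / k)) has_derivative
      (\<lambda>v. 0 - (2 * x$1 * v$1 + 2 * x$2 * v$2) * inverse (rad x) * (1 / k))) (at x)"
    by (intro has_derivative_diff has_derivative_const has_derivative_mult_left ln)
  moreover have "0 - (2 * x$1 * v$1 + 2 * x$2 * v$2) * inverse (rad x) * (1 / k) =
      cutoff_grad k 1 x * v$1 + cutoff_grad k 2 x * v$2" for v :: "real^2"
    unfolding cutoff_grad_def using assms rad_nonzero[of x] by (simp add: field_simps)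
  ultimately have "((\<lambda>x. 1 - ln (rad x) / k) has_derivative
      (\<lambda>v. cutoff_grad k 1 x * v$1 + cutoff_grad k 2 x * v$2)) (at x)"
    by simp
  from has_derivative_compose[OF this
      pos_part_square_has_derivative[THEN has_field_derivative_imp_has_derivative]]
  show ?thesis by (simp add: cutoff_def)
qed

lemma pd_cutoff_square:
  assumes "k > 0"
  shows "pd i (\<lambda>x. (cutoff k x)\<^sup>2) x = 2 * cutoff k x * cutoff_grad k i x"
  using exhaust_2[of i] pd_eqI[OF cutoff_square_has_derivative[OF assms]]
  by (auto simp: axis_def)

lemma cutoff_square_differentiable:
  "k > 0 \<Longrightarrow> (\<lambda>x. (cutoff k x)\<^sup>2) differentiable (at x)"
  using cutoff_square_has_derivative differentiable_def by blast

lemma continuous_on_rad: "continuous_on S rad"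
  unfolding rad_def[abs_def] by (intro continuous_intros)

lemma continuous_on_inverse_rad: "continuous_on S (\<lambda>x. 1 / rad x)"
  by (intro continuous_on_divide continuous_on_const continuous_on_rad)
     (simp add: rad_nonzero)

lemma continuous_on_cutoff: "continuous_on S (cutoff k)"
  unfolding cutoff_def[abs_def] divide_inverse
  by (intro continuous_on_max continuous_on_const continuous_on_diff continuous_on_mult
      continuous_on_ln continuous_on_rad) (simp add: rad_nonzero)

lemma continuous_on_cutoff_grad: "continuous_on S (cutoff_grad k i)"
proof -
  have "continuous_on S (\<lambda>x. - (2 * x$i * (1 / rad x) * (1 / k)))"
    by (intro continuous_on_minus continuous_on_mult continuous_on_const
        continuous_on_inverse_rad continuous_on_component continuous_on_id)
  then show ?thesis by (simp add: cutoff_grad_def[abs_def])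
qed

text \<open>The integral of \<open>1 / rad\<close> diverges only logarithmically, that is, linearly
  in \<open>k\<close> on the support of the cutoff; the factor \<open>1 / k^2\<close> therefore
  wins.\<close>

lemma cutoff_grad_bound:
  assumes "k > 0"
  shows "(cutoff_grad k 1 x)\<^sup>2 + (cutoff_grad k 2 x)\<^sup>2 \<le> 4 / k\<^sup>2 * (1 / rad x)"
proof -
  have "(cutoff_grad k 1 x)\<^sup>2 + (cutoff_grad k 2 x)\<^sup>2 =
      4 / k\<^sup>2 * (((x$1)\<^sup>2 + (x$2)\<^sup>2) / (rad x)\<^sup>2)"
    by (simp add: cutoff_grad_def power_divide power_mult_distrib add_divide_distrib distrib_left
        mult.commute)
  also have "\<dots> = 4 / k\<^sup>2 * ((rad x - 1) / (rad x)\<^sup>2)" by (simp add: rad_def)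
  also have "\<dots> \<le> 4 / k\<^sup>2 * (rad x / (rad x)\<^sup>2)"
    using rad_pos[of x] by (intro mult_left_mono divide_right_mono) auto
  finally show ?thesis using rad_pos[of x] by (simp add: power2_eq_square)
qed

text \<open>The threshold is a lower bound for \<open>rad\<close> on the boundary of the square of
  half side \<open>exp (k/2)\<close>, so the boundary terms of the divergence theorem vanish
  there.\<close>

lemma cutoff_eq_0:
  assumes "k > 0" "rad x \<ge> 1 + (exp (k/2))\<^sup>2"
  shows "cutoff k x = 0"
proof -
  have "exp k \<le> rad x" using assms(2) by (simp add: exp_double[symmetric] )
  then have "k \<le> ln (rad x)" using rad_pos[of x] by (simp add: ln_ge_iff)
  then show ?thesis using assms(1) by (simp add: cutoff_def)
qed

text \<open>On a square both integrations are explicit: the inner one gives a difference of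
  arctangents, at most \<open>pi\<close>, and the outer one integrates
  \<open>1 / sqrt (1 + t^2)\<close>.\<close>

lemma integral_inverse_rad_le:
  assumes "R \<ge> 0"
  shows "integral (cbox (-R, -R) (R, R)) (\<lambda>p. 1 / rad (pt p)) \<le> 2 * pi * arsinh R"
proof -
  define c where "c = (\<lambda>t::real. sqrt (1 + t\<^sup>2))"
  have c: "c t > 0" "(c t)\<^sup>2 = 1 + t\<^sup>2" for t
    by (auto simp: c_def add_pos_nonneg)
  have inner: "integral (cbox (-R) R) (\<lambda>s. 1 / rad (pt (s, t))) =
      arctan (R / c t) / c t - arctan (-R / c t) / c t" for t
  proof (rule integral_unique, subst interval_cbox[symmetric], rule fundamental_theorem_of_calculus)
    show "-R \<le> R" using assms by simp
    fix s assume "s \<in> {-R..R}"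
    have "((\<lambda>s. arctan (s / c t) / c t) has_real_derivative
        inverse (1 + (s / c t)\<^sup>2) * (1 / c t) / c t) (at s)"
      by (intro DERIV_cdivide DERIV_chain2[OF DERIV_arctan] DERIV_ident)
    moreover have "rad (pt (s, t)) = (c t)\<^sup>2 + s\<^sup>2" by (simp add: rad_def c(2))
    moreover from this have "1 + (s / c t)\<^sup>2 = rad (pt (s, t)) / (c t)\<^sup>2"
      using c(1)[of t] by (simp add: field_simps)
    ultimately have "((\<lambda>s. arctan (s / c t) / c t) has_real_derivative 1 / rad (pt (s, t))) (at s)"
      using c(1)[of t] by (simp add: power2_eq_square)
    then show "((\<lambda>s. arctan (s / c t) / c t) has_vector_derivative 1 / rad (pt (s, t)))
        (at s within {-R..R})"
      by (simp add: has_real_derivative_iff_has_vector_derivative has_vector_derivative_at_within)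
  qed
  have "integral (cbox (-R, -R) (R, R)) (\<lambda>p. 1 / rad (pt p)) =
      integral (cbox (-R) R) (\<lambda>t. arctan (R / c t) / c t - arctan (-R / c t) / c t)"
    unfolding integral_pt_iterated(2)[OF continuous_on_inverse_rad] inner ..
  also have "\<dots> \<le> integral (cbox (-R) R) (\<lambda>t. pi * (1 / c t))"
  proof (rule integral_le)
    have cc: "continuous_on S c" for S unfolding c_def by (intro continuous_intros)
    have c0: "c t \<noteq> 0" for t using c(1)[of t] by simp
    show "(\<lambda>t. arctan (R / c t) / c t - arctan (-R / c t) / c t) integrable_on cbox (-R) R"
      by (intro integrable_continuous continuous_intros cc) (auto simp: c0)
    show "(\<lambda>t. pi * (1 / c t)) integrable_on cbox (-R) R"
      by (intro integrable_continuous continuous_intros cc) (auto simp: c0)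
    fix t
    have "(arctan (R / c t) - arctan (-R / c t)) / c t \<le> pi / c t"
      using arctan_bounded[of "R / c t"] arctan_bounded[of "-R / c t"] c(1)[of t]
      by (intro divide_right_mono) auto
    then show "arctan (R / c t) / c t - arctan (-R / c t) / c t \<le> pi * (1 / c t)"
      by (simp add: diff_divide_distrib)
  qed
  also have "\<dots> = pi * arsinh R - pi * arsinh (-R)"
  proof (rule integral_unique, subst interval_cbox[symmetric], rule fundamental_theorem_of_calculus)
    show "-R \<le> R" using assms by simp
    fix t assume "t \<in> {-R..R}"
    have "((\<lambda>t. pi * arsinh t) has_real_derivative pi * (1 / c t)) (at t)"
      unfolding c_def by (auto intro!: derivative_eq_intros simp: add.commute)
    then show "((\<lambda>t. pi * arsinh t) has_vector_derivative pi * (1 / c t)) (at t within {-R..R})"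
      by (simp add: has_real_derivative_iff_has_vector_derivative has_vector_derivative_at_within)
  qed
  finally show ?thesis by simp
qed

text \<open>For \<open>R >= 1\<close>, \<open>arsinh R\<close> is at most \<open>ln (3 * R)\<close>,
  here at most \<open>2 + k/2\<close>; this is where the condition \<open>k >= 4\<close> comes
  from.\<close>

lemma arsinh_exp_le:
  fixes k :: real
  assumes "k \<ge> 4"
  shows "arsinh (exp (k/2)) \<le> k"
proof -
  let ?R = "exp (k/2)"
  have R: "?R \<ge> 1" using assms by simp
  have "sqrt (?R\<^sup>2 + 1) \<le> 2 * ?R"
  proof (rule real_le_lsqrt)
    show "?R\<^sup>2 + 1 \<le> (2 * ?R)\<^sup>2"
      using one_le_power[OF R, of 2] by (simp add: power_mult_distrib)
  qed (use R in linarith)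
  then have "arsinh ?R \<le> ln (3 * ?R)"
    unfolding arsinh_real_def using R by (intro ln_mono) (auto intro: add_pos_nonneg)
  also have "\<dots> = ln 3 + k/2" by (subst ln_mult) auto
  also have "ln (3::real) \<le> 2" using ln_le_minus_one[of "3::real"] by simp
  finally show ?thesis using assms by simp
qed

text \<open>Integrate \<open>div (\<zeta>\<^sup>2 S)\<close>, where \<open>\<zeta>\<close> is the logarithmic cutoff, with Dirichlet energy \<open>O(1/k)\<close>.\<close>

lemma riccati_field_energy:
  assumes S: "smooth S1" "smooth S2"
    and div: "\<And>x. ((S1 x)\<^sup>2 + (S2 x)\<^sup>2) / 2 \<le> pd 1 S1 x + pd 2 S2 x"
    and k: "k \<ge> 4"
  shows "integral (cbox (-exp (k/2), -exp (k/2)) (exp (k/2), exp (k/2)))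
      (\<lambda>p. (cutoff k (pt p))\<^sup>2 * ((S1 (pt p))\<^sup>2 + (S2 (pt p))\<^sup>2)) \<le> 128 * pi / k"
proof -
  define R where "R = exp (k/2)"
  define Q where "Q = (\<lambda>x. (cutoff k x)\<^sup>2)"
  have R: "R > 0" by (simp add: R_def)
  have k0: "k > 0" using k by simp
  have dQ: "Q differentiable (at x)" for x
    unfolding Q_def by (rule cutoff_square_differentiable[OF k0])
  have pdQ: "pd i Q x = 2 * cutoff k x * cutoff_grad k i x" for i x
    unfolding Q_def by (rule pd_cutoff_square[OF k0])
  have Q0: "Q x = 0" if "\<bar>x$1\<bar> = R \<or> \<bar>x$2\<bar> = R" for x
  proof -
    have "R\<^sup>2 \<le> (x$1)\<^sup>2 + (x$2)\<^sup>2" using that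
      by (metis power2_abs zero_le_power2 le_add_same_cancel1 le_add_same_cancel2)
    then show ?thesis using cutoff_eq_0[OF k0, of x] by (simp add: Q_def rad_def R_def)
  qed
  have cQ: "continuous_on UNIV Q"
    unfolding Q_def by (intro continuous_intros continuous_on_cutoff)
  have dS: "S1 differentiable (at x)" "S2 differentiable (at x)" for x
    by (intro smooth_differentiable S)+
  have cS: "continuous_on UNIV S1" "continuous_on UNIV S2"
    "continuous_on UNIV (pd i S1)" "continuous_on UNIV (pd i S2)" for i
    by (intro smooth_continuous_on smooth_pd S)+
  define D1 where "D1 = pd 1 (\<lambda>x. Q x * S1 x)"
  define D2 where "D2 = pd 2 (\<lambda>x. Q x * S2 x)"
  have D1: "D1 = (\<lambda>x. Q x * pd 1 S1 x + 2 * cutoff k x * cutoff_grad k 1 x * S1 x)"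
    by (rule ext) (simp add: D1_def pd_mult dQ dS pdQ)
  have D2: "D2 = (\<lambda>x. Q x * pd 2 S2 x + 2 * cutoff k x * cutoff_grad k 2 x * S2 x)"
    by (rule ext) (simp add: D2_def pd_mult dQ dS pdQ)
  have cD: "continuous_on UNIV D1" "continuous_on UNIV D2"
    unfolding D1 D2 by (intro continuous_intros cQ cS continuous_on_cutoff continuous_on_cutoff_grad)+
  have "integral (cbox (-R) R) (\<lambda>s. D1 (pt (s, t))) = 0" for t
    using integral_unique[OF integral_pd_1[of "\<lambda>x. Q x * S1 x" "-R" R t]] R
    by (simp add: D1_def dQ dS Q0)
  then have I1: "integral (cbox (-R, -R) (R, R)) (\<lambda>p. D1 (pt p)) = 0"
    by (simp add: integral_pt_iterated(2) cD)
  have "integral (cbox (-R) R) (\<lambda>s. D2 (pt (t, s))) = 0" for t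
    using integral_unique[OF integral_pd_2[of "\<lambda>x. Q x * S2 x" "-R" R t]] R
    by (simp add: D2_def dQ dS Q0)
  then have I2: "integral (cbox (-R, -R) (R, R)) (\<lambda>p. D2 (pt p)) = 0"
    by (simp add: integral_pt_iterated(1) cD)
  define E where "E = (\<lambda>x. (cutoff k x)\<^sup>2 * ((S1 x)\<^sup>2 + (S2 x)\<^sup>2))"
  have cE: "continuous_on UNIV E"
    unfolding E_def by (intro continuous_intros continuous_on_cutoff cS)
  have pw: "E x \<le> 4 * D1 x + 4 * D2 x + 64 / k\<^sup>2 * (1 / rad x)" for x
  proof -
    let ?z = "cutoff k x" and ?g = "cutoff_grad k 1 x" and ?h = "cutoff_grad k 2 x"
    have "?z\<^sup>2 * (((S1 x)\<^sup>2 + (S2 x)\<^sup>2) / 2) \<le> ?z\<^sup>2 * (pd 1 S1 x + pd 2 S2 x)"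
      using div[of x] by (intro mult_left_mono) auto
    then have "?z\<^sup>2 * ((S1 x)\<^sup>2 + (S2 x)\<^sup>2) / 2 \<le> ?z\<^sup>2 * pd 1 S1 x + ?z\<^sup>2 * pd 2 S2 x"
      by (simp add: distrib_left)
    \<comment> \<open>Young's inequality, weighted so that the cross term costs only half of the
      energy gained from \<open>div\<close>; the quarter left over explains the factors 4 and
      64.\<close>
    moreover have "0 \<le> (?z * S1 x / 2 + 2 * ?g)\<^sup>2 + (?z * S2 x / 2 + 2 * ?h)\<^sup>2" by simp
    then have "- (2 * ?z * ?g * S1 x + 2 * ?z * ?h * S2 x) \<le>
        ?z\<^sup>2 * ((S1 x)\<^sup>2 + (S2 x)\<^sup>2) / 4 + 4 * (?g\<^sup>2 + ?h\<^sup>2)"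
      by (simp add: power2_eq_square algebra_simps add_divide_distrib)
    moreover have "4 * (?g\<^sup>2 + ?h\<^sup>2) \<le> 16 / k\<^sup>2 * (1 / rad x)"
      using cutoff_grad_bound[OF k0, of x] by simp
    moreover have "e \<le> 4 * (a + u) + 4 * (b + v) + 64 / k\<^sup>2 * (1 / rad x)"
      if "e / 2 \<le> a + b" "- (u + v) \<le> e / 4 + g" "g \<le> 16 / k\<^sup>2 * (1 / rad x)" for e a b u v g
      using that by simp
    ultimately show ?thesis
      unfolding D1 D2 E_def Q_def by blast
  qed
  have "integral (cbox (-R, -R) (R, R)) (\<lambda>p. E (pt p)) \<le> integral (cbox (-R, -R) (R, R))
      (\<lambda>p. 4 * D1 (pt p) + 4 * D2 (pt p) + 64 / k\<^sup>2 * (1 / rad (pt p)))"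
    by (intro integral_le integrable_continuous continuous_intros continuous_on_comp_pt[of E]
        continuous_on_comp_pt[of D1] continuous_on_comp_pt[of D2]
        continuous_on_comp_pt[of "\<lambda>x. 1 / rad x"] cE cD continuous_on_inverse_rad pw)
  also have "\<dots> = 64 / k\<^sup>2 * integral (cbox (-R, -R) (R, R)) (\<lambda>p. 1 / rad (pt p))"
  proof -
    have i: "(\<lambda>p. D1 (pt p)) integrable_on cbox (-R, -R) (R, R)"
      "(\<lambda>p. D2 (pt p)) integrable_on cbox (-R, -R) (R, R)"
      "(\<lambda>p. 1 / rad (pt p)) integrable_on cbox (-R, -R) (R, R)"
      by (intro integrable_continuous continuous_on_comp_pt[of D1] continuous_on_comp_pt[of D2]
        continuous_on_comp_pt[of "\<lambda>x. 1 / rad x"] cD continuous_on_inverse_rad)+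
    have "((\<lambda>p. 4 * D1 (pt p) + 4 * D2 (pt p) + 64 / k\<^sup>2 * (1 / rad (pt p))) has_integral
        4 * 0 + 4 * 0 + 64 / k\<^sup>2 * integral (cbox (-R, -R) (R, R)) (\<lambda>p. 1 / rad (pt p)))
        (cbox (-R, -R) (R, R))"
      using i[THEN integrable_integral] unfolding I1 I2
      by (intro has_integral_add has_integral_mult_right)
    then show ?thesis by (simp add: integral_unique)
  qed
  also have "\<dots> \<le> 64 / k\<^sup>2 * (2 * pi * k)"
  proof (rule mult_left_mono)
    have "2 * pi * arsinh R \<le> 2 * pi * k"
      using arsinh_exp_le[OF k] unfolding R_def by (intro mult_left_mono) auto
    then show "integral (cbox (-R, -R) (R, R)) (\<lambda>p. 1 / rad (pt p)) \<le> 2 * pi * k"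
      using integral_inverse_rad_le[of R] R by linarith
  qed simp
  also have "\<dots> = 128 * pi / k" using k0 by (simp add: power2_eq_square)
  finally show ?thesis unfolding R_def E_def .
qed

text \<open>On a fixed square around \<open>x\<close> the cutoff is at least 1/2 for large
  \<open>k\<close>, while the cut off energy tends to 0. So the energy on the fixed square vanishes,
  and continuity makes this pointwise.\<close>

lemma riccati_field_eq_0:
  assumes S: "smooth S1" "smooth S2"
    and div: "\<And>x. ((S1 x)\<^sup>2 + (S2 x)\<^sup>2) / 2 \<le> pd 1 S1 x + pd 2 S2 x"
  shows "S1 x = 0 \<and> S2 x = 0"
proof -
  define e where "e = (\<lambda>x. (S1 x)\<^sup>2 + (S2 x)\<^sup>2)"
  have ce: "continuous_on UNIV e"
    unfolding e_def by (intro continuous_intros smooth_continuous_on S)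
  define M where "M = 1 + \<bar>x$1\<bar> + \<bar>x$2\<bar>"
  let ?B = "\<lambda>R. cbox (-R, -R) (R, R) :: (real \<times> real) set"
  define J where "J = integral (?B M) (\<lambda>p. e (pt p))"
  have int: "(\<lambda>p. e (pt p)) integrable_on ?B M"
    by (intro integrable_continuous continuous_on_comp_pt ce)
  \<comment> \<open>The second condition on \<open>k\<close> makes the cutoff at least 1/2 on the
    square of half side \<open>M\<close>; the third puts that square inside the one of half side
    \<open>exp (k/2)\<close>. The constant is 4 times 128, the 4 undoing the square of 1/2.\<close>
  have bd: "J \<le> 512 * pi / k" if k: "k \<ge> 4" "k \<ge> 2 * ln (1 + 2 * M\<^sup>2)" "k \<ge> 2 * M" for k
  proof -
    have k0: "k > 0" using k by simp
    define R where "R = exp (k/2)"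
    have "M \<le> R" using exp_ge_add_one_self[of "k/2"] k(3) unfolding R_def by linarith
    then have sub: "?B M \<subseteq> ?B R" by (auto simp: cbox_Pair_eq)
    have cint: "(\<lambda>p. 4 * ((cutoff k (pt p))\<^sup>2 * e (pt p))) integrable_on cbox a b" for a b
      by (intro integrable_continuous continuous_intros continuous_on_comp_pt[of e]
          continuous_on_comp_pt[of "cutoff k"] ce continuous_on_cutoff)
    have "J \<le> integral (?B M) (\<lambda>p. 4 * ((cutoff k (pt p))\<^sup>2 * e (pt p)))"
      unfolding J_def
    proof (rule integral_le[OF int cint])
      fix p assume p: "p \<in> ?B M"
      have "(fst p)\<^sup>2 \<le> M\<^sup>2" "(snd p)\<^sup>2 \<le> M\<^sup>2"
        using p by (auto simp: cbox_Pair_eq abs_le_square_iff[symmetric] M_def abs_le_iff)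
      then have "rad (pt p) \<le> 1 + 2 * M\<^sup>2" by (simp add: rad_def)
      then have "ln (rad (pt p)) \<le> k / 2"
        using rad_pos[of "pt p"] k(2) by (smt (verit) ln_le_cancel_iff field_sum_of_halves)
      then have "ln (rad (pt p)) / k \<le> 1/2" using k0 by (simp add: field_simps)
      then have "1/2 \<le> cutoff k (pt p)" unfolding cutoff_def by linarith
      then have "(1/2)\<^sup>2 \<le> (cutoff k (pt p))\<^sup>2" by (intro power_mono) auto
      then have "1 * e (pt p) \<le> (4 * (cutoff k (pt p))\<^sup>2) * e (pt p)"
        by (intro mult_right_mono) (auto simp: power2_eq_square e_def)
      then show "e (pt p) \<le> 4 * ((cutoff k (pt p))\<^sup>2 * e (pt p))" by simp
    qed
    also have "\<dots> \<le> integral (?B R) (\<lambda>p. 4 * ((cutoff k (pt p))\<^sup>2 * e (pt p)))"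
      by (intro integral_subset_le sub cint) (simp add: e_def)
    also have "\<dots> = 4 * integral (?B R) (\<lambda>p. (cutoff k (pt p))\<^sup>2 * e (pt p))" by simp
    also have "\<dots> \<le> 4 * (128 * pi / k)"
      using riccati_field_energy[OF S div k(1)] unfolding R_def e_def by simp
    finally show ?thesis by simp
  qed
  have "J \<le> 0"
  proof (rule field_le_epsilon)
    fix d :: real assume d: "d > 0"
    define k where "k = Max {4, 2 * ln (1 + 2 * M\<^sup>2), 2 * M, 512 * pi / d}"
    have k: "k \<ge> 4" "k \<ge> 2 * ln (1 + 2 * M\<^sup>2)" "k \<ge> 2 * M" "k \<ge> 512 * pi / d"
      unfolding k_def by auto
    have "J \<le> 512 * pi / k" using bd k by blast
    also have "\<dots> \<le> d" using k(1,4) d by (simp add: field_simps)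
    finally show "J \<le> 0 + d" by simp
  qed
  moreover have "J \<ge> 0" unfolding J_def by (intro integral_nonneg int) (simp add: e_def)
  ultimately have "((\<lambda>p. e (pt p)) has_integral 0) (?B M)"
    using integrable_integral[OF int] unfolding J_def by (metis order_antisym)
  moreover have "box (-M, -M) (M, M) \<noteq> ({} :: (real \<times> real) set)"
    by (auto simp: box_ne_empty Basis_prod_def M_def)
  moreover have "(x$1, x$2) \<in> ?B M" by (auto simp: cbox_Pair_eq M_def)
  ultimately have "e (pt (x$1, x$2)) = 0"
    by (intro has_integral_0_cbox_imp_0[OF continuous_on_comp_pt[OF ce]]) (auto simp: e_def)
  then show ?thesis using pt_surj[of x] by (simp add: e_def sum_power2_eq_zero_iff)
qed

text \<open>The field \<open>S = Y / (2 - F)\<close> satisfies \<open>div S \<ge> |S|\<^sup>2 / 2\<close>.\<close>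

lemma liouville_field:
  assumes sm: "smooth Y1" "smooth Y2" "smooth F"
    and F: "\<And>x. F x \<le> 1"
    and div: "\<And>x. 0 \<le> pd 1 Y1 x + pd 2 Y2 x"
    and flux: "\<And>x. ((Y1 x)\<^sup>2 + (Y2 x)\<^sup>2) / 2 \<le> Y1 x * pd 1 F x + Y2 x * pd 2 F x"
  shows "Y1 x = 0 \<and> Y2 x = 0"
proof -
  \<comment> \<open>If \<open>Y\<close> is the flux of \<open>F\<close> under a linear operator,
    \<open>S\<close> is the flux of \<open>- ln p\<close>. Any constant above the bound 1 of
    \<open>F\<close> would keep \<open>p\<close> away from 0.\<close>
  define p where "p = (\<lambda>x. 2 - F x)"
  have p: "p x \<ge> 1" for x using F[of x] by (simp add: p_def)
  then have p0: "p x > 0" "p x \<noteq> 0" for x by (smt (verit))+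
  have smp: "smooth p" unfolding p_def by (intro smooth_intros sm)
  have pdp: "pd i p x = - pd i F x" for i x
    unfolding p_def using sm by (simp add: pd_diff pd_const smooth_differentiable)
  define S1 where "S1 = (\<lambda>x. Y1 x / p x)"
  define S2 where "S2 = (\<lambda>x. Y2 x / p x)"
  have smS: "smooth S1" "smooth S2"
    unfolding S1_def S2_def by (intro smooth_divide smp sm p0)+
  have Y: "Y1 = (\<lambda>x. p x * S1 x)" "Y2 = (\<lambda>x. p x * S2 x)"
    using p0 by (auto simp: S1_def S2_def)
  have pdY: "pd i Y1 x = p x * pd i S1 x - pd i F x * S1 x"
    "pd i Y2 x = p x * pd i S2 x - pd i F x * S2 x" for i x
    unfolding Y using smS smp by (simp_all add: pd_mult pdp smooth_differentiable)
  have "S1 x = 0 \<and> S2 x = 0"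
  proof (rule riccati_field_eq_0[OF smS])
    fix x
    have "0 \<le> p x * (pd 1 S1 x + pd 2 S2 x) - (pd 1 F x * S1 x + pd 2 F x * S2 x)"
      using div[of x] by (simp add: pdY algebra_simps)
    moreover have "p x * (p x * (((S1 x)\<^sup>2 + (S2 x)\<^sup>2) / 2)) \<le>
        p x * (pd 1 F x * S1 x + pd 2 F x * S2 x)"
      using flux[of x] by (simp add: Y power2_eq_square algebra_simps)
    then have "p x * (((S1 x)\<^sup>2 + (S2 x)\<^sup>2) / 2) \<le> pd 1 F x * S1 x + pd 2 F x * S2 x"
      using p0(1)[of x] by (simp only: mult_le_cancel_left_pos)
    ultimately have "p x * (((S1 x)\<^sup>2 + (S2 x)\<^sup>2) / 2) \<le> p x * (pd 1 S1 x + pd 2 S2 x)"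
      by linarith
    then show "((S1 x)\<^sup>2 + (S2 x)\<^sup>2) / 2 \<le> pd 1 S1 x + pd 2 S2 x"
      using p0(1)[of x] by (simp only: mult_le_cancel_left_pos)
  qed
  then show ?thesis by (simp add: Y)
qed

section \<open>Minkowski graphs\<close>

lemma pd_eq_0_imp_const:
  assumes "\<And>x. f differentiable (at x)" "\<And>i x. pd i f x = 0"
  shows "f x = f y"
proof -
  have "(f has_derivative (\<lambda>v. 0)) (at x within UNIV)" for x
    using has_derivative_pd[OF assms(1)[of x]] by (simp add: assms(2))
  then obtain c where "\<And>x. x \<in> UNIV \<Longrightarrow> f x = c"
    using has_derivative_zero_constant[of UNIV f] by auto
  then show ?thesis by simp
qed

text \<open>The hypothesis says that the endomorphism with matrix \<open>b\<close> is self-adjoint for the inner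
  product \<open>(I + p p\<^sup>T)\<^sup>-\<^sup>1\<close>; hence its eigenvalues are real.\<close>

lemma trace_square_ge:
  fixes p1 p2 b11 b12 b21 b22 :: real
  assumes sa: "(1 + p2\<^sup>2) * b12 - p1 * p2 * b22 = (1 + p1\<^sup>2) * b21 - p1 * p2 * b11"
  shows "(b11 + b22)\<^sup>2 / 2 \<le> b11\<^sup>2 + 2 * b12 * b21 + b22\<^sup>2"
proof -
  define a d b where "a = 1 + p1\<^sup>2" and "d = 1 + p2\<^sup>2" and "b = p1 * p2"
  have ad: "a * d \<ge> 1 + b\<^sup>2"
    unfolding a_def d_def b_def by (simp add: power_mult_distrib algebra_simps)
  have eq: "d * b12 - a * b21 = b * (b22 - b11)"
    using sa unfolding a_def d_def b_def by (simp add: algebra_simps)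
  \<comment> \<open>The left side is \<open>a * d\<close> times the discriminant of the matrix. The
    product \<open>4 * (d * b12) * (a * b21)\<close> is polarised because self-adjointness
    determines the difference of its two factors.\<close>
  have "a * d * ((b11 - b22)\<^sup>2 + 4 * b12 * b21) =
      a * d * (b11 - b22)\<^sup>2 + (d * b12 + a * b21)\<^sup>2 - (d * b12 - a * b21)\<^sup>2"
    by (simp add: power2_eq_square algebra_simps)
  also have "\<dots> = (a * d - b\<^sup>2) * (b11 - b22)\<^sup>2 + (d * b12 + a * b21)\<^sup>2"
    unfolding eq by (simp add: power2_eq_square algebra_simps)
  also have "\<dots> \<ge> 0" using ad by simp
  finally have "0 \<le> (b11 - b22)\<^sup>2 + 4 * b12 * b21"
    using ad by (smt (verit) zero_le_mult_iff zero_le_power2)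
  then show ?thesis by (simp add: power2_eq_square field_simps)
qed

text \<open>Self-adjointness reads \<open>B (I + p p^T) = (I + p p^T) B^T\<close>. Applied to
  \<open>p\<close>, an eigenvector of \<open>I + p p^T\<close> with eigenvalue
  \<open>1 + |p|^2\<close>, it gives both components.\<close>

lemma self_adjoint_flux:
  fixes p1 p2 b11 b12 b21 b22 f :: real
  assumes "(1 + p2\<^sup>2) * b12 - p1 * p2 * b22 = (1 + p1\<^sup>2) * b21 - p1 * p2 * b11"
  shows "p1 * b11 + p2 * b21 - f * p1 +
      p1 * (p1 * (p1 * b11 + p2 * b21 - f * p1) + p2 * (p1 * b12 + p2 * b22 - f * p2)) =
      (1 + p1\<^sup>2 + p2\<^sup>2) * (b11 * p1 + b12 * p2 - f * p1)"
    and "p1 * b12 + p2 * b22 - f * p2 +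
      p2 * (p1 * (p1 * b11 + p2 * b21 - f * p1) + p2 * (p1 * b12 + p2 * b22 - f * p2)) =
      (1 + p1\<^sup>2 + p2\<^sup>2) * (b21 * p1 + b22 * p2 - f * p2)"
  using assms by algebra+

text \<open>Uniform ellipticity: \<open>y\<close> is the image of \<open>f\<close> under
  \<open>(I + p p^T) / v\<close>, whose eigenvalues are \<open>v\<close> and \<open>1 / v\<close>.
  Hence \<open>|y|^2 <= v * (y . f)\<close>, and \<open>v\<close> is at most 2.\<close>

lemma flux_lower_bound:
  fixes p1 p2 f1 f2 v y1 y2 :: real
  assumes v: "0 < v" "v \<le> 2" "v\<^sup>2 = 1 + p1\<^sup>2 + p2\<^sup>2"
    and y: "v * y1 = f1 + p1 * (p1 * f1 + p2 * f2)" "v * y2 = f2 + p2 * (p1 * f1 + p2 * f2)"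
  shows "(y1\<^sup>2 + y2\<^sup>2) / 2 \<le> y1 * f1 + y2 * f2"
proof -
  define s where "s = p1 * f1 + p2 * f2"
  have cs: "s\<^sup>2 \<le> (v\<^sup>2 - 1) * (f1\<^sup>2 + f2\<^sup>2)"
  proof -
    have "(p1\<^sup>2 + p2\<^sup>2) * (f1\<^sup>2 + f2\<^sup>2) - s\<^sup>2 = (p1 * f2 - p2 * f1)\<^sup>2"
      unfolding s_def by (simp add: power2_eq_square algebra_simps)
    then show ?thesis unfolding v(3) by (smt (verit) zero_le_power2)
  qed
  have e: "v * (y1 * f1 + y2 * f2) = f1\<^sup>2 + f2\<^sup>2 + s\<^sup>2"
  proof -
    have "v * (y1 * f1 + y2 * f2) = (v * y1) * f1 + (v * y2) * f2" by (simp add: algebra_simps)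
    then show ?thesis unfolding y s_def by (simp add: power2_eq_square algebra_simps)
  qed
  have "v\<^sup>2 * (y1\<^sup>2 + y2\<^sup>2) = (v * y1)\<^sup>2 + (v * y2)\<^sup>2"
    by (simp add: power_mult_distrib algebra_simps)
  also have "\<dots> = f1\<^sup>2 + f2\<^sup>2 + 2 * s\<^sup>2 + (p1\<^sup>2 + p2\<^sup>2) * s\<^sup>2"
    unfolding y s_def[symmetric] by (simp add: s_def power2_eq_square algebra_simps)
  also have "\<dots> \<le> v\<^sup>2 * (f1\<^sup>2 + f2\<^sup>2 + s\<^sup>2)"
    using cs unfolding v(3) by (simp add: algebra_simps)
  finally have "y1\<^sup>2 + y2\<^sup>2 \<le> v * (y1 * f1 + y2 * f2)"
    using v(1) unfolding e by simp
  also have "\<dots> \<le> 2 * (y1 * f1 + y2 * f2)"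
  proof (rule mult_right_mono[OF v(2)])
    have "0 \<le> v * (y1 * f1 + y2 * f2)" unfolding e by simp
    then show "0 \<le> y1 * f1 + y2 * f2" using v(1) by (simp add: zero_le_mult_iff)
  qed
  finally show ?thesis by simp
qed

text \<open>\<open>X\<close> is the horizontal part of the Minkowski unit normal of the graph of \<open>w\<close>, and \<open>2 F = div X\<close>
  is the Minkowski mean curvature. The flux \<open>Y = (BX - FX) / w\<close> with \<open>B = DX\<close> equals
  \<open>(DF + (X \<bullet> DF) X) / V\<close>, so \<open>div Y\<close> is the Laplacian of \<open>F\<close> up to a positive factor;
  it is nonnegative because \<open>w div Y = tr B\<^sup>2 - (tr B)\<^sup>2 / 2\<close>.\<close>

lemma cmc_graph_rigidity:
  fixes w V :: "real^2 \<Rightarrow> real"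
  defines "X \<equiv> \<lambda>i x. V x * pd i w x"
  assumes sm: "smooth w" "smooth V"
    and w: "\<And>x. 0 < w x" "\<And>x. w x \<le> 1"
    and V: "\<And>x. 0 < V x" "\<And>x. (V x)\<^sup>2 * (1 - (pd 1 w x)\<^sup>2 - (pd 2 w x)\<^sup>2) = 1"
      "\<And>x. V x \<le> 1 + w x"
    and H: "H \<ge> 1"
    and cmc: "\<And>x. w x * (pd 1 (X 1) x + pd 2 (X 2) x) = 2 * (V x - H)"
  shows "pd i w x = 0"
proof -
  have V2: "V x \<le> 2" for x using V(3)[of x] w(2)[of x] by simp
  have wn: "w x \<noteq> 0" for x using w(1)[of x] by simp
  have smX: "smooth (X i)" for i unfolding X_def by (intro smooth_intros sm)
  define F where "F = (\<lambda>x. (V x - H) / w x)"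
  have smF: "smooth F" unfolding F_def by (intro smooth_intros sm w)
  have wF: "w x * F x = V x - H" for x using wn by (simp add: F_def)
  have trB: "pd 1 (X 1) x + pd 2 (X 2) x = 2 * F x" for x
    using cmc[of x] wn[of x] by (simp add: F_def field_simps)
  \<comment> \<open>From \<open>H >= 1\<close> and the angle bound, \<open>V - H <= w\<close>;
    dividing by \<open>w\<close> gives 1 however small \<open>w\<close> is.\<close>
  have F1: "F x \<le> 1" for x
    using V(3)[of x] H w(1)[of x] by (simp add: F_def)
  note d = smooth_differentiable[OF sm(1)] smooth_differentiable[OF sm(2)]
    smooth_differentiable[OF smX] smooth_differentiable[OF smF]
    smooth_differentiable[OF smooth_pd[OF smX]] smooth_differentiable[OF smooth_pd[OF sm(1)]]
  have Xw: "X i x = V x * pd i w x" for i x by (simp add: X_def)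
  have VX: "(V x)\<^sup>2 = 1 + (X 1 x)\<^sup>2 + (X 2 x)\<^sup>2" for x
    using V(2)[of x] by (simp add: Xw power_mult_distrib algebra_simps)
  have dV: "V x * pd i V x = X 1 x * pd i (X 1) x + X 2 x * pd i (X 2) x" for i x
  proof -
    have "(\<lambda>x. V x * V x) = (\<lambda>x. 1 + X 1 x * X 1 x + X 2 x * X 2 x)"
      using VX by (simp add: power2_eq_square)
    from arg_cong[OF this, of "\<lambda>f. pd i f x"] show ?thesis
      by (simp add: pd_mult pd_add pd_const d)
  qed
  have dF: "w x * pd i F x = pd i V x - pd i w x * F x" for i x
  proof -
    have "(\<lambda>x. w x * F x) = (\<lambda>x. V x - H)" using wF by simp
    from arg_cong[OF this, of "\<lambda>f. pd i f x"] show ?thesis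
      by (simp add: pd_mult pd_diff pd_const d)
  qed
  have dX: "pd j (X i) x = V x * pd j (pd i w) x + pd j V x * pd i w x" for i j x
    unfolding X_def by (simp add: pd_mult d)
  \<comment> \<open>Since second derivatives of \<open>w\<close> commute, the curl of
    \<open>V Dw\<close> involves only \<open>DV\<close>, which \<open>dV\<close> expresses through
    the derivatives of \<open>X\<close>.\<close>
  have sa: "(1 + (X 2 x)\<^sup>2) * pd 2 (X 1) x - X 1 x * X 2 x * pd 2 (X 2) x =
      (1 + (X 1 x)\<^sup>2) * pd 1 (X 2) x - X 1 x * X 2 x * pd 1 (X 1) x" for x
  proof -
    have "pd 2 (X 1) x - pd 1 (X 2) x = pd 2 V x * pd 1 w x - pd 1 V x * pd 2 w x"
      using pd_commute[OF sm(1), of x] by (simp add: dX)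
    then have "(V x)\<^sup>2 * (pd 2 (X 1) x - pd 1 (X 2) x) =
        (V x * pd 2 V x) * X 1 x - (V x * pd 1 V x) * X 2 x"
      by (simp only:) (simp add: Xw power2_eq_square algebra_simps)
    then show ?thesis unfolding VX dV by (simp add: power2_eq_square algebra_simps)
  qed
  define Y where "Y = (\<lambda>i x. (pd 1 (X i) x * X 1 x + pd 2 (X i) x * X 2 x - F x * X i x) / w x)"
  have smY: "smooth (Y i)" for i
    unfolding Y_def by (intro smooth_intros sm smX smF w)
  note d = d smooth_differentiable[OF smY]
  have wY: "w x * Y i x = pd 1 (X i) x * X 1 x + pd 2 (X i) x * X 2 x - F x * X i x" for i x
    using wn by (simp add: Y_def)
  have VY: "V x * Y i x = pd i F x + X i x * (X 1 x * pd 1 F x + X 2 x * pd 2 F x)" for i x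
  proof -
    \<comment> \<open>Up to the factor \<open>w * V\<close>, the gradient of \<open>F\<close> is
      \<open>B^T X - F X\<close>; \<open>self_adjoint_flux\<close> then exchanges \<open>B^T\<close>
      for \<open>B\<close>.\<close>
    have *: "w x * V x * pd j F x = X 1 x * pd j (X 1) x + X 2 x * pd j (X 2) x - F x * X j x" for j
    proof -
      have "w x * V x * pd j F x = V x * (w x * pd j F x)" by simp
      also have "\<dots> = V x * pd j V x - F x * (V x * pd j w x)" unfolding dF by (simp add: algebra_simps)
      finally show ?thesis by (simp add: dV) (simp add: Xw)
    qed
    have "w x * V x * (pd i F x + X i x * (X 1 x * pd 1 F x + X 2 x * pd 2 F x)) =
        (w x * V x * pd i F x) + X i x * (X 1 x * (w x * V x * pd 1 F x) + X 2 x * (w x * V x * pd 2 F x))"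
      by (simp add: algebra_simps)
    also have "\<dots> = (V x)\<^sup>2 * (w x * Y i x)"
      unfolding * wY VX 
      by (rule disjE[OF exhaust_2[of i]]) (simp_all only: self_adjoint_flux[OF sa[of x], of "F x"])
    also have "\<dots> = w x * V x * (V x * Y i x)" by (simp add: power2_eq_square)
    finally show ?thesis using wn[of x] V(1)[of x] by simp
  qed
  have divY: "w x * (pd 1 (Y 1) x + pd 2 (Y 2) x) =
      (pd 1 (X 1) x)\<^sup>2 + 2 * pd 2 (X 1) x * pd 1 (X 2) x + (pd 2 (X 2) x)\<^sup>2 - 2 * (F x)\<^sup>2" for x
  proof -
    have dwY: "pd j (Y i) x * w x = pd j (pd 1 (X i)) x * X 1 x + pd 1 (X i) x * pd j (X 1) x
        + pd j (pd 2 (X i)) x * X 2 x + pd 2 (X i) x * pd j (X 2) x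
        - pd j F x * X i x - F x * pd j (X i) x - pd j w x * Y i x" for i j
    proof -
      have "(\<lambda>x. w x * Y i x) =
          (\<lambda>x. pd 1 (X i) x * X 1 x + pd 2 (X i) x * X 2 x - F x * X i x)" using wY by simp
      from arg_cong[OF this, of "\<lambda>f. pd j f x"] show ?thesis
        by (simp add: pd_mult pd_diff pd_add d algebra_simps)
    qed
    have dtr: "pd j (pd 1 (X 1)) x + pd j (pd 2 (X 2)) x = 2 * pd j F x" for j
    proof -
      have "(\<lambda>x. pd 1 (X 1) x + pd 2 (X 2) x) = (\<lambda>x. 2 * F x)" using trB by simp
      from arg_cong[OF this, of "\<lambda>f. pd j f x"] show ?thesis
        by (simp add: pd_mult pd_add pd_const d)
    qed
    \<comment> \<open>The Codazzi equation in coordinates: commuting derivatives turn the divergence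
      of a column of \<open>B\<close> into a derivative of its trace \<open>2 F\<close>.\<close>
    have div1: "pd 1 (pd 1 (X 1)) x + pd 2 (pd 1 (X 2)) x = 2 * pd 1 F x"
      and div2: "pd 1 (pd 2 (X 1)) x + pd 2 (pd 2 (X 2)) x = 2 * pd 2 F x"
      using pd_commute[OF smX, of 1 x] pd_commute[OF smX, of 2 x] dtr[of 1] dtr[of 2] by linarith+
    \<comment> \<open>In the expansion of \<open>w div Y\<close>, Codazzi contributes
      \<open>2 X . DF\<close>, while differentiating \<open>F\<close> and \<open>w\<close> removes
      \<open>X . DF\<close> and \<open>Dw . Y\<close>. Their equality leaves no first order
      term.\<close>
    have cancel: "X 1 x * pd 1 F x + X 2 x * pd 2 F x = pd 1 w x * Y 1 x + pd 2 w x * Y 2 x"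
    proof -
      have "V x * (w x * (X 1 x * pd 1 F x + X 2 x * pd 2 F x)) =
          X 1 x * (V x * (w x * pd 1 F x)) + X 2 x * (V x * (w x * pd 2 F x))"
        by (simp add: algebra_simps)
      also have "\<dots> = X 1 x * (V x * pd 1 V x - X 1 x * F x) + X 2 x * (V x * pd 2 V x - X 2 x * F x)"
        unfolding dF by (simp add: Xw algebra_simps)
      also have "\<dots> = X 1 x * (w x * Y 1 x) + X 2 x * (w x * Y 2 x)"
        unfolding dV wY by (simp add: algebra_simps)
      also have "\<dots> = V x * (w x * (pd 1 w x * Y 1 x + pd 2 w x * Y 2 x))"
        by (simp add: Xw algebra_simps)
      finally show ?thesis using V(1)[of x] wn[of x] by simp
    qed
    have "w x * (pd 1 (Y 1) x + pd 2 (Y 2) x) = pd 1 (Y 1) x * w x + pd 2 (Y 2) x * w x"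
      by (simp add: algebra_simps)
    also have "\<dots> = (pd 1 (pd 1 (X 1)) x + pd 2 (pd 1 (X 2)) x) * X 1 x
        + (pd 1 (pd 2 (X 1)) x + pd 2 (pd 2 (X 2)) x) * X 2 x
        + (pd 1 (X 1) x)\<^sup>2 + 2 * pd 2 (X 1) x * pd 1 (X 2) x + (pd 2 (X 2) x)\<^sup>2
        - (X 1 x * pd 1 F x + X 2 x * pd 2 F x) - F x * (pd 1 (X 1) x + pd 2 (X 2) x)
        - (pd 1 w x * Y 1 x + pd 2 w x * Y 2 x)"
      unfolding dwY by (simp add: power2_eq_square algebra_simps)
    finally show ?thesis
      unfolding div1 div2 trB cancel[symmetric] by (simp add: power2_eq_square algebra_simps)
  qed
  have Y0: "Y 1 x = 0 \<and> Y 2 x = 0" for x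
  proof (rule liouville_field[OF smY smY smF F1])
    fix x
    have "0 \<le> w x * (pd 1 (Y 1) x + pd 2 (Y 2) x)"
      using trace_square_ge[OF sa[of x]] unfolding divY trB by (simp add: power2_eq_square)
    then show "0 \<le> pd 1 (Y 1) x + pd 2 (Y 2) x"
      using w(1)[of x] by (simp add: zero_le_mult_iff)
    show "((Y 1 x)\<^sup>2 + (Y 2 x)\<^sup>2) / 2 \<le> Y 1 x * pd 1 F x + Y 2 x * pd 2 F x"
      by (rule flux_lower_bound[OF V(1) V2 VX VY VY])
  qed
  have F0: "pd i F x = 0" for i x
  proof -
    \<comment> \<open>With \<open>Y = 0\<close>, the gradient of \<open>F\<close> lies in the kernel
      of \<open>I + X X^T\<close>, which is trivial; pairing with \<open>X\<close> shows it.\<close>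
    define s where "s = X 1 x * pd 1 F x + X 2 x * pd 2 F x"
    have f: "pd 1 F x = - X 1 x * s" "pd 2 F x = - X 2 x * s"
      using VY[of x 1] VY[of x 2] Y0[of x] by (simp_all add: s_def)
    have "(V x)\<^sup>2 * s = s + X 1 x * (X 1 x * s) + X 2 x * (X 2 x * s)"
      unfolding VX by (simp add: power2_eq_square algebra_simps)
    also have "\<dots> = s - X 1 x * pd 1 F x - X 2 x * pd 2 F x" using f by simp
    finally have "s = 0" using V(1)[of x] by (simp add: s_def)
    then show ?thesis using f exhaust_2[of i] by auto
  qed
  have Fc: "F y = F 0" for y
    by (rule pd_eq_0_imp_const[OF d(4) F0])
  have fl: "((X 1 x)\<^sup>2 + (X 2 x)\<^sup>2) / 2 \<le> X 1 x * pd 1 w x + X 2 x * pd 2 w x" for x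
  proof -
    have "((X 1 x)\<^sup>2 + (X 2 x)\<^sup>2) / 2 = V x / 2 * (X 1 x * pd 1 w x + X 2 x * pd 2 w x)"
      by (simp add: Xw power2_eq_square algebra_simps)
    also have "\<dots> \<le> 1 * (X 1 x * pd 1 w x + X 2 x * pd 2 w x)"
      using V2[of x] V(1)[of x] by (intro mult_right_mono)
        (auto simp: Xw mult.assoc intro!: add_nonneg_nonneg mult_nonneg_nonneg[of "V x"])
    finally show ?thesis by simp
  qed
  \<comment> \<open>The divergence \<open>2 F\<close> of \<open>X\<close> now has one sign. The pair
    \<open>X\<close>, \<open>w\<close> serves if it is nonnegative, \<open>- X\<close>,
    \<open>- w\<close> otherwise; both \<open>w\<close> and \<open>- w\<close> are bounded above by
    1.\<close>
  have "X 1 x = 0 \<and> X 2 x = 0"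
  proof (cases "F 0 \<ge> 0")
    case True
    show ?thesis
      by (rule liouville_field[OF smX smX sm(1) w(2) _ fl]) (simp add: trB, metis True Fc)
  next
    case False
    have "- X 1 x = 0 \<and> - X 2 x = 0"
    proof (rule liouville_field)
      show "smooth (\<lambda>x. - X 1 x)" "smooth (\<lambda>x. - X 2 x)" "smooth (\<lambda>x. - w x)"
        by (intro smooth_minus smX sm)+
      show "- w x \<le> 1" for x using w(1)[of x] by simp
      show "0 \<le> pd 1 (\<lambda>x. - X 1 x) x + pd 2 (\<lambda>x. - X 2 x) x" for x
        using trB[of x] Fc[of x] False by (simp add: pd_minus d)
      show "((- X 1 x)\<^sup>2 + (- X 2 x)\<^sup>2) / 2 \<le>
          - X 1 x * pd 1 (\<lambda>x. - w x) x + - X 2 x * pd 2 (\<lambda>x. - w x) x" for x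
        using fl[of x] by (simp add: pd_minus d)
    qed
    then show ?thesis by simp
  qed
  then show ?thesis using V(1)[of x] exhaust_2[of i] by (auto simp: Xw)
qed

section \<open>Geometry of vertical graphs\<close>

text \<open>In the conformal time \<open>-e\<^sup>-\<^sup>t\<close> the metric is a multiple of the Minkowski metric and the graph
  of \<open>u\<close> becomes that of \<open>-w\<close>. The vector field \<open>n\<close> is the horizontal part of the unit normal,
  and \<open>V\<close> the hyperbolic cosine of the angle.\<close>

locale spacelike_graph =
  fixes u :: "real^2 \<Rightarrow> real" and \<psi> :: surface
  assumes smooth_u: "smooth u"
    and \<psi>: "\<psi> = (\<lambda>x. (u x, x))"
    and spacelike: "\<And>x. (pd 1 u x)\<^sup>2 + (pd 2 u x)\<^sup>2 < exp (2 * u x)"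
begin

definition w :: "real^2 \<Rightarrow> real" where
  "w x = exp (- u x)"

definition V :: "real^2 \<Rightarrow> real" where
  "V x = (1 - (pd 1 w x * pd 1 w x + pd 2 w x * pd 2 w x)) powr (- 1 / 2)"

text \<open>The future Minkowski unit normal is \<open>(V, - V Dw)\<close>; the conformal factor
  contributes the extra \<open>w\<close>.\<close>

definition n :: "2 \<Rightarrow> real^2 \<Rightarrow> real" where
  "n i x = - (w x * (V x * pd i w x))"

lemma w_pos: "w x > 0"
  by (simp add: w_def)

lemma w_exp: "(w x)\<^sup>2 * exp (2 * u x) = 1"
  by (simp add: w_def power2_eq_square exp_add[symmetric])

lemma smooth_w: "smooth w"
  unfolding w_def[abs_def] by (intro smooth_intros smooth_u)

lemma pd_w: "pd i w x = - (w x * pd i u x)"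
proof -
  have "pd i (\<lambda>y. exp (- u y)) x = exp (- u x) * pd i (\<lambda>y. - u y) x"
    by (intro pd_chain[where \<phi> = exp] DERIV_exp smooth_differentiable smooth_intros smooth_u)
  then show ?thesis
    by (simp add: w_def[abs_def] pd_minus smooth_differentiable smooth_u)
qed

lemma gradient_w: "(pd 1 w x)\<^sup>2 + (pd 2 w x)\<^sup>2 < 1"
proof -
  have "(pd 1 w x)\<^sup>2 + (pd 2 w x)\<^sup>2 = (w x)\<^sup>2 * ((pd 1 u x)\<^sup>2 + (pd 2 u x)\<^sup>2)"
    by (simp add: pd_w power_mult_distrib algebra_simps)
  also have "\<dots> < (w x)\<^sup>2 * exp (2 * u x)"
    using spacelike[of x] w_pos[of x] by (intro mult_strict_left_mono) auto
  finally show ?thesis by (simp add: w_exp)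
qed

lemma V_pos: "V x > 0"
  using gradient_w[of x] by (simp add: V_def power2_eq_square)

lemma V_square: "(V x)\<^sup>2 * (1 - (pd 1 w x)\<^sup>2 - (pd 2 w x)\<^sup>2) = 1"
proof -
  define q where "q = 1 - (pd 1 w x * pd 1 w x + pd 2 w x * pd 2 w x)"
  have q: "q > 0" using gradient_w[of x] by (simp add: q_def power2_eq_square)
  have "(V x)\<^sup>2 = q powr (- 1 / 2 + - 1 / 2)"
    unfolding V_def q_def[symmetric] power2_eq_square powr_add ..
  also have "\<dots> = 1 / q" using q by (simp add: powr_neg_one)
  finally have "(V x)\<^sup>2 = 1 / q" .
  moreover have "1 - (pd 1 w x)\<^sup>2 - (pd 2 w x)\<^sup>2 = q" by (simp add: q_def power2_eq_square)
  ultimately show ?thesis using q by simp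
qed

lemma V_ge_1: "V x \<ge> 1"
proof -
  have "1 = (V x)\<^sup>2 * (1 - (pd 1 w x)\<^sup>2 - (pd 2 w x)\<^sup>2)" by (simp add: V_square)
  also have "\<dots> \<le> (V x)\<^sup>2 * 1" by (intro mult_left_mono) (auto intro: add_nonneg_nonneg)
  finally have "1\<^sup>2 \<le> (V x)\<^sup>2" by simp
  then show ?thesis using V_pos[of x] power2_le_imp_le[of 1 "V x"] by simp
qed

lemma smooth_V: "smooth V"
  unfolding V_def[abs_def] using gradient_w
  by (intro smooth_powr smooth_intros smooth_w) (simp add: power2_eq_square)

lemma smooth_n: "smooth (n i)"
  unfolding n_def[abs_def] by (intro smooth_intros smooth_w smooth_V)

text \<open>Orthogonality of the normal to the coordinate tangent vectors
  \<open>(pd i u x, axis i 1)\<close>.\<close>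

lemma exp_n: "exp (2 * u x) * n i x = V x * pd i u x"
proof -
  have "exp (2 * u x) * n i x = ((w x)\<^sup>2 * exp (2 * u x)) * (V x * pd i u x)"
    by (simp add: n_def pd_w power2_eq_square)
  then show ?thesis by (simp add: w_exp)
qed

text \<open>The normalisation of the normal, whose time component is \<open>V\<close>, to square
  norm -1.\<close>

lemma normal_norm: "exp (2 * u x) * (n 1 x * n 1 x + n 2 x * n 2 x) = V x * V x - 1"
proof -
  have "exp (2 * u x) * (n 1 x * n 1 x + n 2 x * n 2 x) =
      ((w x)\<^sup>2 * exp (2 * u x)) * ((V x)\<^sup>2 * ((pd 1 w x)\<^sup>2 + (pd 2 w x)\<^sup>2))"
    by (simp add: n_def power2_eq_square algebra_simps)
  also have "\<dots> = (V x)\<^sup>2 * ((pd 1 w x)\<^sup>2 + (pd 2 w x)\<^sup>2)" by (simp only: w_exp mult_1)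
  also have "\<dots> = (V x)\<^sup>2 - (V x)\<^sup>2 * (1 - (pd 1 w x)\<^sup>2 - (pd 2 w x)\<^sup>2)"
    by (simp add: algebra_simps)
  also have "\<dots> = V x * V x - 1"
    unfolding V_square by (simp add: power2_eq_square)
  finally show ?thesis .
qed

section \<open>Unit normal and hyperbolic angle\<close>

lemma fst_\<psi> [simp]: "fst (\<psi> x) = u x"
  by (simp add: \<psi>)

lemma tangent_map_eq: "tangent_map \<psi> x X = (X$1 * pd 1 u x + X$2 * pd 2 u x, X)"
  unfolding tangent_map_def \<psi>
  by (subst frechet_derivative_eqI[OF has_derivative_Pair[OF
        has_derivative_pd[OF smooth_differentiable[OF smooth_u]] has_derivative_ident]]) simp

lemma inner_vec2: "(v :: real^2) \<bullet> z = v$1 * z$1 + v$2 * z$2"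
  by (simp add: inner_vec_def sum_2)

definition normal :: surface where
  "normal x = (V x, n 1 x *\<^sub>R axis 1 1 + n 2 x *\<^sub>R axis 2 1)"

lemma snd_normal_nth [simp]: "snd (normal x) $ 1 = n 1 x" "snd (normal x) $ 2 = n 2 x"
  by (simp_all add: normal_def axis_def)

lemma unit_normal_eq: "unit_normal \<psi> = normal"
proof
  fix x
  show "unit_normal \<psi> x = normal x"
    unfolding unit_normal_def
  proof (rule the_equality)
    have "ss_metric (\<psi> x) (normal x) (tangent_map \<psi> x X) = 0" for X
    proof -
      have "ss_metric (\<psi> x) (normal x) (tangent_map \<psi> x X) =
          - (V x * (X$1 * pd 1 u x + X$2 * pd 2 u x)) +
          ((exp (2 * u x) * n 1 x) * X$1 + (exp (2 * u x) * n 2 x) * X$2)"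
        by (simp add: ss_metric_def tangent_map_eq inner_vec2 algebra_simps)
           (simp add: normal_def)
      then show ?thesis unfolding exp_n by (simp add: algebra_simps)
    qed
    moreover have "ss_metric (\<psi> x) (normal x) (normal x) = - (V x * V x) +
        exp (2 * u x) * (n 1 x * n 1 x + n 2 x * n 2 x)"
      by (simp add: ss_metric_def inner_vec2) (simp add: normal_def)
    moreover have "ss_metric (\<psi> x) (normal x) d_t < 0"
      using V_pos[of x] by (simp add: ss_metric_def d_t_def normal_def)
    ultimately show "(\<forall>X. ss_metric (\<psi> x) (normal x) (tangent_map \<psi> x X) = 0) \<and>
        ss_metric (\<psi> x) (normal x) (normal x) = - 1 \<and> ss_metric (\<psi> x) (normal x) d_t < 0"
      by (simp add: normal_norm)
  next
    fix m assume m: "(\<forall>X. ss_metric (\<psi> x) m (tangent_map \<psi> x X) = 0) \<and>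
        ss_metric (\<psi> x) m m = - 1 \<and> ss_metric (\<psi> x) m d_t < 0"
    define f where "f = fst m"
    \<comment> \<open>Orthogonality to the tangent plane leaves only the time component
      \<open>f\<close> free; the norm then fixes its square and the time orientation its
      sign.\<close>
    have o: "exp (2 * u x) * snd m $ i = f * pd i u x" for i
    proof -
      have "ss_metric (\<psi> x) m (tangent_map \<psi> x (axis i 1)) = 0" using m by blast
      then show ?thesis
        using exhaust_2[of i]
        by (auto simp: ss_metric_def tangent_map_eq inner_vec2 f_def axis_def)
    qed
    have mi: "snd m $ i = f * ((w x)\<^sup>2 * pd i u x)" for i
    proof -
      have "((w x)\<^sup>2 * exp (2 * u x)) * snd m $ i = (w x)\<^sup>2 * (exp (2 * u x) * snd m $ i)" by simp
      then show ?thesis unfolding o w_exp by (simp add: algebra_simps)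
    qed
    have f0: "f > 0" using m by (simp add: ss_metric_def d_t_def f_def)
    have "- (f * f) + exp (2 * u x) * (snd m $ 1 * snd m $ 1 + snd m $ 2 * snd m $ 2) = - 1"
      using m by (simp add: ss_metric_def inner_vec2 f_def)
    moreover have "exp (2 * u x) * (snd m $ 1 * snd m $ 1 + snd m $ 2 * snd m $ 2) =
        (exp (2 * u x) * snd m $ 1) * snd m $ 1 + (exp (2 * u x) * snd m $ 2) * snd m $ 2"
      by (simp add: algebra_simps)
    also have "\<dots> = f * pd 1 u x * snd m $ 1 + f * pd 2 u x * snd m $ 2"
      by (simp only: o)
    also have "\<dots> = f\<^sup>2 * ((pd 1 w x)\<^sup>2 + (pd 2 w x)\<^sup>2)"
      by (simp add: mi pd_w power2_eq_square algebra_simps)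
    ultimately have "f\<^sup>2 * (1 - (pd 1 w x)\<^sup>2 - (pd 2 w x)\<^sup>2) = 1"
      by (simp add: power2_eq_square algebra_simps)
    then have "f\<^sup>2 * (1 - (pd 1 w x)\<^sup>2 - (pd 2 w x)\<^sup>2) = (V x)\<^sup>2 * (1 - (pd 1 w x)\<^sup>2 - (pd 2 w x)\<^sup>2)"
      by (simp only: V_square)
    then have "f\<^sup>2 = (V x)\<^sup>2" using gradient_w[of x] by simp
    then have fV: "f = V x" using f0 V_pos[of x] by (simp add: power2_eq_iff_nonneg)
    have "snd m $ i = n i x" for i
      unfolding mi fV n_def pd_w by (simp add: power2_eq_square)
    then have "snd m = snd (normal x)" by (simp add: vec_eq_iff forall_2)
    moreover have "fst m = fst (normal x)" using fV by (simp add: f_def normal_def)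
    ultimately show "m = normal x" by (simp add: prod_eq_iff)
  qed
qed

lemma cosh_hyperbolic_angle: "cosh (hyperbolic_angle \<psi> x) = V x"
proof -
  have V: "- ss_metric (\<psi> x) (unit_normal \<psi> x) d_t = V x"
    by (simp add: unit_normal_eq ss_metric_def d_t_def normal_def)
  have "\<exists>!\<theta>. \<theta> \<ge> 0 \<and> cosh \<theta> = V x"
  proof (rule ex1I)
    show "arcosh (V x) \<ge> 0 \<and> cosh (arcosh (V x)) = V x"
      using V_ge_1[of x] by (simp add: cosh_arcosh_real)
    show "\<theta> = arcosh (V x)" if "\<theta> \<ge> 0 \<and> cosh \<theta> = V x" for \<theta>
      using that arcosh_cosh_real by metis
  qed
  from theI'[OF this] show ?thesis unfolding hyperbolic_angle_def V by blast
qed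

section \<open>Shape operator and mean curvature\<close>

lemma normal_has_derivative:
  "(normal has_derivative (\<lambda>v. (v$1 * pd 1 V x + v$2 * pd 2 V x,
     (v$1 * pd 1 (n 1) x + v$2 * pd 2 (n 1) x) *\<^sub>R axis 1 1 +
     (v$1 * pd 1 (n 2) x + v$2 * pd 2 (n 2) x) *\<^sub>R axis 2 1))) (at x)"
  unfolding normal_def[abs_def]
  by (intro has_derivative_Pair has_derivative_add has_derivative_scaleR_left has_derivative_pd
      smooth_differentiable smooth_V smooth_n)

text \<open>A tangent vector of a graph has its plane coordinates as second component, so the shape
  operator can be read off there once the covariant derivative is known to be tangent.\<close>

definition shape :: "real^2 \<Rightarrow> real^2 \<Rightarrow> real^2" where
  "shape x X = - snd (cov_deriv_along \<psi> normal x X)"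

lemma cov_deriv_normal:
  "cov_deriv_along \<psi> normal x X =
    (X$1 * pd 1 V x + X$2 * pd 2 V x + exp (2 * u x) * (X$1 * n 1 x + X$2 * n 2 x),
     (X$1 * pd 1 (n 1) x + X$2 * pd 2 (n 1) x) *\<^sub>R axis 1 1 +
     (X$1 * pd 1 (n 2) x + X$2 * pd 2 (n 2) x) *\<^sub>R axis 2 1 +
     ((X$1 * pd 1 u x + X$2 * pd 2 u x) *\<^sub>R snd (normal x) + V x *\<^sub>R X))"
  unfolding cov_deriv_along_def frechet_derivative_eqI[OF normal_has_derivative]
    ss_christoffel_eq tangent_map_eq
  by (simp add: inner_vec2) (simp add: normal_def)

text \<open>Half the derivative of \<open>normal_norm\<close>; it is what makes the covariant
  derivative of the normal tangent to the surface.\<close>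

lemma normal_norm_derivative:
  "exp (2 * u x) * (n 1 x * pd i (n 1) x + n 2 x * pd i (n 2) x) +
     exp (2 * u x) * pd i u x * (n 1 x * n 1 x + n 2 x * n 2 x) = V x * pd i V x"
proof -
  define E where "E = (\<lambda>x. exp (2 * u x))"
  have sm: "smooth (\<lambda>x. 2 * u x)" by (rule smooth_mult[OF smooth_const smooth_u])
  have e: "smooth E" unfolding E_def by (rule smooth_exp[OF sm])
  have "pd i E x = exp (2 * u x) * pd i (\<lambda>x. 2 * u x) x"
    unfolding E_def
    by (rule pd_chain[where \<phi> = exp and f = "\<lambda>x. 2 * u x", OF smooth_differentiable[OF sm] DERIV_exp])
  then have de: "pd i E x = 2 * E x * pd i u x"
    by (simp add: E_def pd_mult pd_const smooth_differentiable smooth_u smooth_const)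
  have "(\<lambda>x. E x * (n 1 x * n 1 x + n 2 x * n 2 x)) = (\<lambda>x. V x * V x - 1)"
    unfolding E_def using normal_norm by simp
  from arg_cong[OF this, of "\<lambda>f. pd i f x"]
  have "E x * (n 1 x * pd i (n 1) x + n 2 x * pd i (n 2) x) +
      E x * pd i u x * (n 1 x * n 1 x + n 2 x * n 2 x) = V x * pd i V x"
    by (simp add: pd_mult pd_add pd_diff pd_const smooth_differentiable smooth_add smooth_mult
        smooth_const smooth_n smooth_V e de algebra_simps)
  then show ?thesis unfolding E_def .
qed

lemma shape_operator_eq: "shape_operator \<psi> x X = shape x X"
proof -
  let ?C = "cov_deriv_along \<psi> normal x X"
  \<comment> \<open>Tangency of the covariant derivative. The factor \<open>V\<close> lets
    \<open>exp_n\<close> trade the slope of the graph for the components of the normal.\<close>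
  have "V x * fst ?C = V x * (snd ?C $ 1 * pd 1 u x + snd ?C $ 2 * pd 2 u x)"
  proof -
    have "V x * (snd ?C $ 1 * pd 1 u x + snd ?C $ 2 * pd 2 u x) =
        snd ?C $ 1 * (V x * pd 1 u x) + snd ?C $ 2 * (V x * pd 2 u x)"
      by (simp add: algebra_simps)
    also have "\<dots> = exp (2 * u x) * (n 1 x * snd ?C $ 1 + n 2 x * snd ?C $ 2)"
      unfolding exp_n[symmetric] by (simp add: algebra_simps)
    also have "\<dots> = X$1 * (exp (2 * u x) * (n 1 x * pd 1 (n 1) x + n 2 x * pd 1 (n 2) x) +
          exp (2 * u x) * pd 1 u x * (n 1 x * n 1 x + n 2 x * n 2 x)) +
        X$2 * (exp (2 * u x) * (n 1 x * pd 2 (n 1) x + n 2 x * pd 2 (n 2) x) +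
          exp (2 * u x) * pd 2 u x * (n 1 x * n 1 x + n 2 x * n 2 x)) +
        V x * (exp (2 * u x) * (X$1 * n 1 x + X$2 * n 2 x))"
      by (simp add: cov_deriv_normal axis_def algebra_simps)
    also have "\<dots> = V x * fst ?C"
      unfolding normal_norm_derivative by (simp add: cov_deriv_normal algebra_simps)
    finally show ?thesis ..
  qed
  then have "fst ?C = snd ?C $ 1 * pd 1 u x + snd ?C $ 2 * pd 2 u x"
    using V_pos[of x] by simp
  then have "tangent_map \<psi> x (shape x X) = - ?C"
    by (simp add: tangent_map_eq shape_def prod_eq_iff)
  moreover have "Y = shape x X" if "tangent_map \<psi> x Y = - ?C" for Y
    using arg_cong[OF that, of snd] by (simp add: tangent_map_eq shape_def)
  ultimately show ?thesis unfolding shape_operator_def unit_normal_eq by (intro the_equality)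
qed

text \<open>With \<open>n = - w V Dw\<close>, the terms from differentiating the factor
  \<open>w\<close> cancel the Christoffel term \<open>Du . n\<close>, because
  \<open>Dw = - w Du\<close>.\<close>

lemma mean_curvature_eq:
  "2 * mean_curvature \<psi> x = 2 * V x -
    w x * (pd 1 (\<lambda>x. V x * pd 1 w x) x + pd 2 (\<lambda>x. V x * pd 2 w x) x)"
proof -
  have dn: "pd i (n i) x = - (w x * pd i (\<lambda>x. V x * pd i w x) x) - pd i w x * (V x * pd i w x)"
    for i
  proof -
    have "smooth (\<lambda>x. V x * pd i w x)" by (intro smooth_intros smooth_V smooth_w)
    then show ?thesis
      unfolding n_def[abs_def]
      by (simp only: pd_minus pd_mult smooth_differentiable smooth_w smooth_mult)
  qed
  have "shape_operator \<psi> x = shape x" by (rule ext) (rule shape_operator_eq)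
  then have "2 * mean_curvature \<psi> x = - (shape x (axis 1 1) $ 1 + shape x (axis 2 1) $ 2)"
    by (simp add: mean_curvature_def trace_def matrix_def sum_2)
  also have "\<dots> = 2 * V x + (pd 1 (n 1) x + pd 2 (n 2) x) + (pd 1 u x * n 1 x + pd 2 u x * n 2 x)"
    by (simp add: shape_def cov_deriv_normal axis_def)
  finally show ?thesis
    unfolding dn by (simp add: n_def pd_w[of 1 x] pd_w[of 2 x] algebra_simps)
qed

end

section \<open>Conclusion for vertical graphs\<close>

lemma spacelike_vertical_graphE:
  assumes "spacelike_vertical_graph \<psi>"
  obtains u where "spacelike_graph u \<psi>" "\<And>x. u x \<ge> 0"
proof -
  obtain u where u: "smooth u" "\<And>x. u x \<ge> 0" "\<And>x. \<psi> x = (u x, x)"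
    and im: "\<And>x X. X \<noteq> 0 \<Longrightarrow> induced_metric \<psi> x X X > 0"
    using assms unfolding spacelike_vertical_graph_def spacelike_immersion_def by blast
  have \<psi>: "\<psi> = (\<lambda>x. (u x, x))" using u(3) by blast
  have T: "tangent_map \<psi> x X = (X$1 * pd 1 u x + X$2 * pd 2 u x, X)" for x X
    unfolding tangent_map_def \<psi>
    by (subst frechet_derivative_eqI[OF has_derivative_Pair[OF
          has_derivative_pd[OF smooth_differentiable[OF u(1)]] has_derivative_ident]]) simp
  have "(pd 1 u x)\<^sup>2 + (pd 2 u x)\<^sup>2 < exp (2 * u x)" for x
  proof (cases "pd 1 u x = 0 \<and> pd 2 u x = 0")
    case False
    define g where "g = (pd 1 u x)\<^sup>2 + (pd 2 u x)\<^sup>2"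
    \<comment> \<open>The gradient of \<open>u\<close> is the steepest direction of the graph, so
      positivity of the induced metric there gives the sharp gradient bound.\<close>
    define X where "X = pt (pd 1 u x, pd 2 u x)"
    have X: "X$1 = pd 1 u x" "X$2 = pd 2 u x" by (simp_all add: X_def)
    have g: "g > 0" using False by (simp add: g_def sum_power2_gt_zero_iff)
    have "X \<noteq> 0" using X False by (metis zero_index)
    then have "0 < induced_metric \<psi> x X X" by (rule im)
    also have "induced_metric \<psi> x X X = g * (exp (2 * u x) - g)"
      by (simp add: induced_metric_def ss_metric_def T u(3) X g_def inner_vec_def sum_2
          power2_eq_square algebra_simps)
    finally show ?thesis using g unfolding g_def[symmetric] by (simp add: zero_less_mult_iff)
  qed simp
  then have "spacelike_graph u \<psi>" using u(1) \<psi> by unfold_locales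
  then show thesis by (rule that[OF _ u(2)])
qed

theorem theorem4p4:
  fixes \<psi> :: surface and H :: real
  assumes "spacelike_vertical_graph \<psi>"
    and "complete_surface \<psi>"
    and "H \<ge> 1"
    and "\<And>x. mean_curvature \<psi> x = H"
    and "\<And>x. ereal (height \<psi> x) \<le>
           (if cosh (hyperbolic_angle \<psi> x) = 1 then \<infinity>
            else ereal (- ln (cosh (hyperbolic_angle \<psi> x) - 1)))"
  shows "\<exists>t0. range \<psi> = slice t0"
proof -
  obtain u where g: "spacelike_graph u \<psi>" and u: "\<And>x. u x \<ge> 0"
    using spacelike_vertical_graphE[OF assms(1)] by blast
  interpret spacelike_graph u \<psi> by (fact g)
  \<comment> \<open>Exponentiating the height bound gives \<open>V - 1 <= w\<close>; at points with
    \<open>V = 1\<close>, where the bound is infinite, this is just \<open>w > 0\<close>.\<close>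
  have Vw: "V x \<le> 1 + w x" for x
  proof (cases "V x = 1")
    case False
    then have V: "V x > 1" using V_ge_1[of x] by simp
    have "ereal (u x) \<le> ereal (- ln (V x - 1))"
      using assms(5)[of x] False unfolding cosh_hyperbolic_angle height_def by simp
    then have "ln (V x - 1) \<le> - u x" by simp
    then have "exp (ln (V x - 1)) \<le> w x" unfolding w_def by (simp only: exp_le_cancel_iff)
    then show ?thesis using V by simp
  qed (use w_pos[of x] in simp)
  have dw: "pd i w x = 0" for i x
  proof (rule cmc_graph_rigidity[OF smooth_w smooth_V w_pos _ V_pos V_square Vw assms(3)])
    show "w x \<le> 1" for x using u[of x] by (simp add: w_def)
    show "w x * (pd 1 (\<lambda>x. V x * pd 1 w x) x + pd 2 (\<lambda>x. V x * pd 2 w x) x) = 2 * (V x - H)" for x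
      using mean_curvature_eq[of x] assms(4)[of x] by simp
  qed
  then have "w x = w 0" for x
    by (intro pd_eq_0_imp_const smooth_differentiable smooth_w)
  then have "u x = u 0" for x by (simp add: w_def)
  then have "\<psi> = (\<lambda>x. (u 0, x))" unfolding \<psi> by (intro ext) simp
  then have "range \<psi> = slice (u 0)" by (auto simp: slice_def)
  then show ?thesis ..
qed

end
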